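(* Given $n\in\mathbb{N}$, $\boldsymbol{x}\in\{0,1\}^n$, $\boldsymbol{w}\in\mathbb{N}^n$ and $B\in\mathbb{N}$ with $w_i\le B$ for all $i\in\{1,\ldots,n\}$, the adversarial problem $$\phi(\boldsymbol{x})=\max\left\{\sum_{i=1}^n x_ic_i : \sum_{i=1}^n w_ic_i\le B,\ c_i\in\{0,1\}\ \text{for all } i\in\{1,\ldots,n\}\right\}$$ can be solved in $O(n)$ time.
   Context: Running time is counted in elementary operations (arithmetic operations and comparisons on the input numbers each take constant time). Solving the problem means computing an optimal $\boldsymbol{c}$ and the value $\phi(\boldsymbol{x})$. *)

theory Defs
  imports Complex_Main "HOL-Library.Landau_Symbols"
begin

section \<open>The adversarial problem\<close>

text \<open>Vectors of length \<open>n\<close> are functions on \<^typ>\<open>nat\<close> of which only the values at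
  \<open>1, \<dots>, n\<close> are ever used.\<close>

definition feasible :: "nat \<Rightarrow> (nat \<Rightarrow> nat) \<Rightarrow> nat \<Rightarrow> (nat \<Rightarrow> nat) \<Rightarrow> bool" where
  "feasible n w B c \<longleftrightarrow> (\<Sum>i=1..n. w i * c i) \<le> B \<and> (\<forall>i\<in>{1..n}. c i \<in> {0, 1})"

definition adversary_value :: "nat \<Rightarrow> (nat \<Rightarrow> nat) \<Rightarrow> nat \<Rightarrow> (nat \<Rightarrow> nat) \<Rightarrow> nat" where
  "adversary_value n w B x = Max {(\<Sum>i=1..n. x i * c i) | c. feasible n w B c}"

text \<open>The maximum is attained, so \<^const>\<open>Max\<close> is meaningful here.\<close>

lemma finite_adversary_values: "finite {(\<Sum>i=1..n. x i * c i) | c. feasible n w B c}"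
proof (rule finite_subset)
  show "{(\<Sum>i=1..n. x i * c i) | c. feasible n w B c} \<subseteq> {..\<Sum>i=1..n. x i}"
  proof clarsimp
    fix c assume "feasible n w B c"
    then have "x i * c i \<le> x i" if "i \<in> {1..n}" for i
      using that unfolding feasible_def by fastforce
    then show "(\<Sum>i=Suc 0..n. x i * c i) \<le> (\<Sum>i=Suc 0..n. x i)"
      by (intro sum_mono) simp
  qed
qed simp

lemma adversary_value_attained:
  "\<exists>c. feasible n w B c \<and> (\<Sum>i=1..n. x i * c i) = adversary_value n w B x"
proof -
  have "feasible n w B (\<lambda>_. 0)"
    by (simp add: feasible_def)
  then have "{(\<Sum>i=1..n. x i * c i) | c. feasible n w B c} \<noteq> {}"
    by blast
  then have "adversary_value n w B x \<in> {(\<Sum>i=1..n. x i * c i) | c. feasible n w B c}"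
    unfolding adversary_value_def by (rule Max_in[OF finite_adversary_values])
  then show ?thesis
    by auto
qed

section \<open>Unit-cost random access programs\<close>

text \<open>Running time is measured on a structured form of the unit-cost random access machine.
  The memory consists of named arrays of integer cells; a scalar is the cell at index 0 of its
  array. Access to a cell with a computed index, addition, subtraction and comparison cost one
  unit each, whatever the size of the operands. Multiplication and division are deliberately not
  primitive: at unit cost and on unbounded integers they would make the machine unreasonably
  powerful, and an upper bound proved without them remains valid when they are added.\<close>

type_synonym vname = string
type_synonym state = "vname \<Rightarrow> int \<Rightarrow> int"

datatype aexp =
    Const int
  | Cell vname aexp
  | Add aexp aexp
  | Sub aexp aexp

datatype bexp =
    Less aexp aexp
  | Eq aexp aexp
  | Neg bexp
  | Conj bexp bexp

datatype com =
    Skip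
  | Assign vname aexp aexp  \<comment> \<open>array, index, new value\<close>
  | Seq com com
  | If bexp com com
  | While bexp com
  | Call nat

fun aval :: "aexp \<Rightarrow> state \<Rightarrow> int" where
  "aval (Const k) s = k"
| "aval (Cell a i) s = s a (aval i s)"
| "aval (Add e f) s = aval e s + aval f s"
| "aval (Sub e f) s = aval e s - aval f s"

fun bval :: "bexp \<Rightarrow> state \<Rightarrow> bool" where
  "bval (Less e f) s \<longleftrightarrow> aval e s < aval f s"
| "bval (Eq e f) s \<longleftrightarrow> aval e s = aval f s"
| "bval (Neg b) s \<longleftrightarrow> \<not> bval b s"
| "bval (Conj b d) s \<longleftrightarrow> bval b s \<and> bval d s"

fun acost :: "aexp \<Rightarrow> nat" where
  "acost (Const k) = 1"
| "acost (Cell a i) = acost i + 1"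
| "acost (Add e f) = acost e + acost f + 1"
| "acost (Sub e f) = acost e + acost f + 1"

fun bcost :: "bexp \<Rightarrow> nat" where
  "bcost (Less e f) = acost e + acost f + 1"
| "bcost (Eq e f) = acost e + acost f + 1"
| "bcost (Neg b) = bcost b + 1"
| "bcost (Conj b d) = bcost b + bcost d + 1"

text \<open>\<open>exec P c s t s'\<close>: command \<open>c\<close>, started in \<open>s\<close>, terminates in \<open>s'\<close> after exactly \<open>t\<close>
  elementary operations. Calls refer to the finite list \<open>P\<close> of procedure bodies, may be recursive,
  and have neither parameters nor local variables: all data lives in the one global memory.\<close>

inductive exec :: "com list \<Rightarrow> com \<Rightarrow> state \<Rightarrow> nat \<Rightarrow> state \<Rightarrow> bool" for P where
  Skip: "exec P Skip s 1 s"
| Assign: "exec P (Assign a i e) s (acost i + acost e + 1)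
             (s(a := (s a)(aval i s := aval e s)))"
| Seq: "exec P c s t s' \<Longrightarrow> exec P d s' u s'' \<Longrightarrow> exec P (Seq c d) s (t + u) s''"
| IfTrue: "bval b s \<Longrightarrow> exec P c s t s' \<Longrightarrow> exec P (If b c d) s (bcost b + 1 + t) s'"
| IfFalse: "\<not> bval b s \<Longrightarrow> exec P d s t s' \<Longrightarrow> exec P (If b c d) s (bcost b + 1 + t) s'"
| WhileFalse: "\<not> bval b s \<Longrightarrow> exec P (While b c) s (bcost b + 1) s"
| WhileTrue: "bval b s \<Longrightarrow> exec P c s t s' \<Longrightarrow> exec P (While b c) s' u s'' \<Longrightarrow>
    exec P (While b c) s (bcost b + 1 + t + u) s''"
| Call: "p < length P \<Longrightarrow> exec P (P ! p) s t s' \<Longrightarrow> exec P (Call p) s (1 + t) s'"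

inductive_cases SkipE: "exec P Skip s t s'"
  and AssignE: "exec P (Assign a i e) s t s'"
  and SeqE: "exec P (Seq c d) s t s'"
  and IfE: "exec P (If b c d) s t s'"
  and WhileE: "exec P (While b c) s t s'"
  and CallE: "exec P (Call p) s t s'"

lemma exec_deterministic:
  assumes "exec P c s t s'" and "exec P c s u s''"
  shows "u = t \<and> s'' = s'"
  using assms
proof (induction arbitrary: u s'' rule: exec.induct)
  case (Skip s)
  then show ?case by (auto elim: SkipE)
next
  case (Assign a i e s)
  then show ?case by (auto elim: AssignE)
next
  case (Seq c s t s' d t' s'')
  from Seq.prems show ?case by (elim SeqE) (auto dest!: Seq.IH)
next
  case (IfTrue b s c t s' d)
  from IfTrue.prems IfTrue.hyps show ?case by (elim IfE) (auto dest!: IfTrue.IH)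
next
  case (IfFalse b s d t s' c)
  from IfFalse.prems IfFalse.hyps show ?case by (elim IfE) (auto dest!: IfFalse.IH)
next
  case (WhileFalse b s c)
  from WhileFalse.prems show ?case by (rule WhileE) (use WhileFalse.hyps in auto)
next
  case (WhileTrue b s c t s' t' s'')
  from WhileTrue.prems show ?case
    by (rule WhileE) (use WhileTrue.hyps(1) in \<open>auto dest!: WhileTrue.IH\<close>)
next
  case (Call p s t s')
  from Call.prems show ?case by (elim CallE) (auto dest!: Call.IH)
qed

text \<open>At the start the cells that do not hold input are 0, as is usual for random access
  machines.\<close>

definition input_state :: "nat \<Rightarrow> (nat \<Rightarrow> nat) \<Rightarrow> (nat \<Rightarrow> nat) \<Rightarrow> nat \<Rightarrow> state" where
  "input_state n x w B = (\<lambda>a i.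
     if a = ''n'' \<and> i = 0 then int n
     else if a = ''B'' \<and> i = 0 then int B
     else if a = ''x'' \<and> 1 \<le> i \<and> i \<le> int n then int (x (nat i))
     else if a = ''w'' \<and> 1 \<le> i \<and> i \<le> int n then int (w (nat i))
     else 0)"

definition correct_output :: "nat \<Rightarrow> (nat \<Rightarrow> nat) \<Rightarrow> (nat \<Rightarrow> nat) \<Rightarrow> nat \<Rightarrow> state \<Rightarrow> bool" where
  "correct_output n x w B s \<longleftrightarrow>
     (\<exists>c. feasible n w B c \<and> (\<Sum>i=1..n. x i * c i) = adversary_value n w B x \<and>
          (\<forall>i\<in>{1..n}. s ''c'' (int i) = int (c i))) \<and>
     s ''phi'' 0 = int (adversary_value n w B x)"

end

theory Submission
  imports Defs
begin

text \<open>Let \<open>p\<close> be such that the items with \<open>x i = 1\<close> and weight below \<open>p\<close> fit into the budget, but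
  those of weight at most \<open>p\<close> do not. Taking all of the former and then items of weight exactly \<open>p\<close>
  while they fit is optimal: summing \<open>p - w i\<close> over the chosen items is maximised pointwise, and the
  budget left over is less than \<open>p\<close>. Such a \<open>p\<close> is found by weighted selection. As pivot serves the
  median of the medians of three medians of three, which is itself a threshold, for unit
  costs and half the number of blocks of nine as budget. At least \<open>2 (m div 9)\<close> of the \<open>m\<close> items are
  discarded, so the time satisfies \<open>T m \<le> T (m div 9) + T (m - 2 (m div 9)) + O(m)\<close> for \<open>m \<ge> 9\<close>,
  which is linear.\<close>

section \<open>Timed total correctness\<close>

text \<open>A Hoare triple for total correctness with a time budget. \<open>exec\<close> records the
  exact cost; the upper bound \<open>t\<close> allows budgets to be rounded up and added.\<close>

definition runs :: "com list \<Rightarrow> com \<Rightarrow> state \<Rightarrow> nat \<Rightarrow> (state \<Rightarrow> bool) \<Rightarrow> bool" where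
  "runs P c s t Q \<longleftrightarrow> (\<exists>u s'. u \<le> t \<and> exec P c s u s' \<and> Q s')"

text \<open>All loop bodies of the program are free of loops and calls. For such code a state
  transformer replaces the relational semantics, so the simplifier can execute it symbolically. The
  catch-all value of \<open>effect\<close> on \<open>While\<close> and \<open>Call\<close> is a
  dummy.\<close>

fun straight :: "com \<Rightarrow> bool" where
  "straight Skip \<longleftrightarrow> True"
| "straight (Assign a i e) \<longleftrightarrow> True"
| "straight (Seq c d) \<longleftrightarrow> straight c \<and> straight d"
| "straight (If b c d) \<longleftrightarrow> straight c \<and> straight d"
| "straight (While b c) \<longleftrightarrow> False"
| "straight (Call p) \<longleftrightarrow> False"

fun effect :: "com \<Rightarrow> state \<Rightarrow> state" where
  "effect (Assign a i e) s = s(a := (s a)(aval i s := aval e s))"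
| "effect (Seq c d) s = effect d (effect c s)"
| "effect (If b c d) s = (if bval b s then effect c s else effect d s)"
| "effect _ s = s"

text \<open>A conditional is charged for both branches, which makes the bound independent of the
  state.\<close>

fun ccost :: "com \<Rightarrow> nat" where
  "ccost (Assign a i e) = acost i + acost e + 1"
| "ccost (Seq c d) = ccost c + ccost d"
| "ccost (If b c d) = bcost b + 1 + ccost c + ccost d"
| "ccost _ = 1"

lemma exec_straight:
  "straight c \<Longrightarrow> \<exists>u\<le>ccost c. exec P c s u (effect c s)"
proof (induction c arbitrary: s)
  case (Seq c d)
  then obtain u v where "u \<le> ccost c" "exec P c s u (effect c s)"
    "v \<le> ccost d" "exec P d (effect c s) v (effect d (effect c s))"
    by fastforce
  then show ?case
    by (intro exI[of _ "u + v"]) (auto intro: exec.Seq)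
next
  case (If b c d)
  then obtain u v where "u \<le> ccost c" "exec P c s u (effect c s)"
    "v \<le> ccost d" "exec P d s v (effect d s)"
    by fastforce
  then show ?case
    using exec.IfTrue[of b s P c u _ d] exec.IfFalse[of b s P d v _ c]
    by (intro exI[of _ "bcost b + 1 + (if bval b s then u else v)"]) auto
qed (use exec.Skip exec.Assign in \<open>force+\<close>)

lemma runs_straight:
  assumes "straight c" "Q (effect c s)" "ccost c \<le> t"
  shows "runs P c s t Q"
  using exec_straight[OF assms(1), of P s] assms(2,3) unfolding runs_def
  by (meson le_trans)

lemma runs_mono:
  assumes "runs P c s t Q" "t \<le> t'" "\<And>s'. Q s' \<Longrightarrow> Q' s'"
  shows "runs P c s t' Q'"
  using assms unfolding runs_def by (meson le_trans)

lemma runs_Seq: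
  assumes "runs P c s t R" "\<And>s'. R s' \<Longrightarrow> runs P d s' t' Q" "t + t' \<le> t''"
  shows "runs P (Seq c d) s t'' Q"
proof -
  obtain u s' where u: "u \<le> t" "exec P c s u s'" "R s'"
    using assms(1) unfolding runs_def by blast
  then obtain v s'' where "v \<le> t'" "exec P d s' v s''" "Q s''"
    using assms(2) unfolding runs_def by blast
  with u assms(3) show ?thesis
    unfolding runs_def by (intro exI[of _ "u + v"] exI[of _ s'']) (auto intro: exec.Seq)
qed

lemma runs_straight_Seq:
  assumes "straight c" "runs P d (effect c s) t Q" "ccost c + t \<le> t'"
  shows "runs P (Seq c d) s t' Q"
proof (rule runs_Seq)
  show "runs P c s (ccost c) (\<lambda>s'. s' = effect c s)"
    using assms(1) by (intro runs_straight) simp_all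
qed (use assms in simp_all)

lemma runs_If:
  assumes "bval b s \<Longrightarrow> runs P c s t Q" "\<not> bval b s \<Longrightarrow> runs P d s t Q"
    and "bcost b + 1 + t \<le> t'"
  shows "runs P (If b c d) s t' Q"
proof (cases "bval b s")
  case True
  then obtain u s' where "u \<le> t" "exec P c s u s'" "Q s'"
    using assms(1) unfolding runs_def by blast
  with True assms(3) show ?thesis
    unfolding runs_def
    by (intro exI[of _ "bcost b + 1 + u"] exI[of _ s'])
      (auto intro: exec.IfTrue[simplified])
next
  case False
  then obtain u s' where "u \<le> t" "exec P d s u s'" "Q s'"
    using assms(2) unfolding runs_def by blast
  with False assms(3) show ?thesis
    unfolding runs_def
    by (intro exI[of _ "bcost b + 1 + u"] exI[of _ s'])
      (auto intro: exec.IfFalse[simplified])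
qed

lemma runs_Call:
  assumes "p < length P" "runs P (P ! p) s t Q" "t + 1 \<le> t'"
  shows "runs P (Call p) s t' Q"
proof -
  obtain u s' where "u \<le> t" "exec P (P ! p) s u s'" "Q s'"
    using assms(2) unfolding runs_def by blast
  with assms(1,3) show ?thesis
    unfolding runs_def by (intro exI[of _ "1 + u"] exI[of _ s']) (auto intro: exec.Call[simplified])
qed

text \<open>The invariant is indexed by the number of completed iterations, and \<open>n\<close> is
  the exact iteration count; the proof is by induction on the iterations left. The factor
  \<open>n + 1\<close> accounts for the final failing test.\<close>

lemma runs_While:
  assumes "straight c" "I 0 s"
    and step: "\<And>k s. k < n \<Longrightarrow> I k s \<Longrightarrow> bval b s \<and> I (Suc k) (effect c s)"
    and last: "\<And>s. I n s \<Longrightarrow> \<not> bval b s \<and> Q s"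
    and "(n + 1) * (bcost b + 1 + ccost c) \<le> t"
  shows "runs P (While b c) s t Q"
proof -
  let ?C = "bcost b + 1 + ccost c"
  have "runs P (While b c) s ((n - k + 1) * ?C) Q" if "k \<le> n" "I k s" for k s
    using that
  proof (induction "n - k" arbitrary: k s)
    case 0
    then have "\<not> bval b s" "Q s"
      using last[of s] by auto
    then show ?case
      unfolding runs_def using exec.WhileFalse[of b s P c]
      by (intro exI[of _ "bcost b + 1"] exI[of _ s]) auto
  next
    case (Suc d)
    then have k: "k < n" by simp
    have b: "bval b s" and I: "I (Suc k) (effect c s)"
      using step[OF k Suc.prems(2)] by auto
    obtain u where u: "u \<le> ccost c" "exec P c s u (effect c s)"
      using exec_straight[OF assms(1)] by blast
    have "d = n - Suc k" "Suc k \<le> n"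
      using Suc.hyps(2) k by auto
    from Suc.hyps(1)[OF this I] obtain v s' where v:
      "v \<le> (n - Suc k + 1) * ?C" "exec P (While b c) (effect c s) v s'" "Q s'"
      unfolding runs_def by blast
    have eq: "n - k + 1 = Suc (n - Suc k + 1)"
      using k by simp
    have "bcost b + 1 + u + v \<le> (n - k + 1) * ?C"
      unfolding eq mult_Suc using u(1) v(1) by linarith
    then show ?case
      unfolding runs_def using exec.WhileTrue[OF b u(2) v(2)] v(3) by blast
  qed
  from this[of 0 s] assms(2,5) show ?thesis
    by (auto intro: runs_mono)
qed

section \<open>Thresholds\<close>

definition cost_sum :: "(int \<times> int) list \<Rightarrow> int" where
  "cost_sum xs = sum_list (map snd xs)"

text \<open>A weighted quantile of (key, cost) pairs: the key at which the cost accumulated in key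
  order first exceeds \<open>b\<close>. With unit costs it is an order statistic.\<close>

definition is_threshold :: "(int \<times> int) list \<Rightarrow> int \<Rightarrow> int \<Rightarrow> bool" where
  "is_threshold xs b p \<longleftrightarrow>
     cost_sum (filter (\<lambda>x. fst x < p) xs) \<le> b \<and> b < cost_sum (filter (\<lambda>x. fst x \<le> p) xs)"

lemma cost_sum_simps [simp]:
  "cost_sum [] = 0" "cost_sum (x # xs) = snd x + cost_sum xs" "cost_sum (xs @ ys) = cost_sum xs + cost_sum ys"
  by (simp_all add: cost_sum_def)

text \<open>Justifies recursion into the keys below a pivot \<open>q\<close>. If \<open>p\<close>
  were at least \<open>q\<close>, the whole sublist would lie below \<open>p\<close>, yet its cost
  exceeds \<open>b\<close>. Hence \<open>p < q\<close>, and the discarded keys enter neither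
  sum.\<close>

lemma is_threshold_below:
  assumes "b < cost_sum (filter (\<lambda>x. fst x < q) xs)"
    and "is_threshold (filter (\<lambda>x. fst x < q) xs) b p"
  shows "is_threshold xs b p"
proof -
  have "p < q"
  proof (rule ccontr)
    assume "\<not> p < q"
    then have "filter (\<lambda>x. fst x < p) (filter (\<lambda>x. fst x < q) xs) = filter (\<lambda>x. fst x < q) xs"
      by (auto intro: filter_cong)
    with assms show False
      by (simp add: is_threshold_def)
  qed
  then have "filter (\<lambda>x. fst x < p) (filter (\<lambda>x. fst x < q) xs) = filter (\<lambda>x. fst x < p) xs"
    "filter (\<lambda>x. fst x \<le> p) (filter (\<lambda>x. fst x < q) xs) = filter (\<lambda>x. fst x \<le> p) xs"
    by (auto intro: filter_cong)
  with assms(2) show ?thesis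
    by (simp add: is_threshold_def)
qed

text \<open>Justifies recursion into the keys above \<open>q\<close> with the budget left after
  paying for all others. If \<open>p\<close> were at most \<open>q\<close>, no key of the sublist
  would be at most \<open>p\<close>, so the remaining budget would be negative.\<close>

lemma is_threshold_above:
  assumes "cost_sum (filter (\<lambda>x. fst x \<le> q) xs) \<le> b"
    and "is_threshold (filter (\<lambda>x. q < fst x) xs) (b - cost_sum (filter (\<lambda>x. fst x \<le> q) xs)) p"
  shows "is_threshold xs b p"
proof -
  have "q < p"
  proof (rule ccontr)
    assume "\<not> q < p"
    then have "filter (\<lambda>x. fst x \<le> p) (filter (\<lambda>x. q < fst x) xs) = []"
      by (auto simp: filter_empty_conv)
    with assms show False
      by (simp add: is_threshold_def)
  qed
  then have "cost_sum (filter (\<lambda>x. fst x < p) xs) = cost_sum (filter (\<lambda>x. fst x \<le> q) xs) +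
      cost_sum (filter (\<lambda>x. fst x < p) (filter (\<lambda>x. q < fst x) xs))"
    "cost_sum (filter (\<lambda>x. fst x \<le> p) xs) = cost_sum (filter (\<lambda>x. fst x \<le> q) xs) +
      cost_sum (filter (\<lambda>x. fst x \<le> p) (filter (\<lambda>x. q < fst x) xs))"
    by (induction xs) auto
  with assms(2) show ?thesis
    by (simp add: is_threshold_def)
qed

lemma cost_sum_split:
  "cost_sum xs = cost_sum (filter (\<lambda>x. fst x \<le> q) xs) + cost_sum (filter (\<lambda>x. q < fst x) xs)"
  by (induction xs) auto

lemma cost_sum_le_split:
  "cost_sum (filter (\<lambda>x. fst x \<le> q) xs) =
     cost_sum (filter (\<lambda>x. fst x < q) xs) + cost_sum (filter (\<lambda>x. fst x = q) xs)"
  by (induction xs) auto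

section \<open>Medians of three and of nine\<close>

definition med3 :: "int \<Rightarrow> int \<Rightarrow> int \<Rightarrow> int" where
  "med3 a b c = max (min a b) (min (max a b) c)"

definition ninther :: "(nat \<Rightarrow> int) \<Rightarrow> int" where
  "ninther f = med3 (med3 (f 0) (f 1) (f 2)) (med3 (f 3) (f 4) (f 5)) (med3 (f 6) (f 7) (f 8))"

text \<open>\<open>T\<close> stands for a one-sided condition such as \<open>y \<le> p\<close> or
  \<open>p \<le> y\<close>. Two of the three inner medians satisfy it, and each of these is backed
  by two of its own three values.\<close>

lemma ninther_majority:
  fixes T :: "int \<Rightarrow> bool"
  assumes "\<And>a b c. T (med3 a b c) \<Longrightarrow> (T a \<and> T b) \<or> (T a \<and> T c) \<or> (T b \<and> T c)"
    and "T (ninther f)"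
  shows "4 \<le> length (filter (\<lambda>r. T (f r)) [0..<9])"
proof -
  \<comment> \<open>Counting with \<open>of_bool\<close> makes the case analysis linear:
    \<open>*\<close> is used for the outer median, \<open>**\<close> for the inner ones.\<close>
  have *: "T (med3 a b c) \<Longrightarrow>
      (2::nat) \<le> of_bool (T a) + of_bool (T b) + of_bool (T c)" for a b c
    using assms(1)[of a b c] by auto
  have **: "2 * of_bool (T (med3 a b c)) \<le>
      (of_bool (T a) + of_bool (T b) + of_bool (T c) :: nat)" for a b c
    using assms(1)[of a b c] by auto
  have eq: "length (filter (\<lambda>r. T (f r)) [0..<9]) =
      of_bool (T (f 0)) + of_bool (T (f 1)) + of_bool (T (f 2)) + of_bool (T (f 3)) +
      of_bool (T (f 4)) + of_bool (T (f 5)) + of_bool (T (f 6)) + of_bool (T (f 7)) +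
      of_bool (T (f 8))"
  proof -
    have "length (filter Q xs) = (\<Sum>x\<leftarrow>xs. of_bool (Q x))" for Q and xs :: "nat list"
      by (induction xs) auto
    moreover have "[0..<9] = [0, 1, 2, 3, 4, 5, 6, 7, 8 :: nat]"
      by (simp add: upt_rec eval_nat_numeral)
    ultimately show ?thesis
      by (simp del: One_nat_def)
  qed
  show ?thesis
    unfolding eq
    using *[OF assms(2)[unfolded ninther_def]]
      **[of "f 0" "f 1" "f 2"] **[of "f 3" "f 4" "f 5"] **[of "f 6" "f 7" "f 8"]
    by linarith
qed

text \<open>The blocks of nine are disjoint, so their contributions of four add up; the positions
  after the last block can only increase the right-hand side.\<close>

lemma ninthers_majority:
  fixes T :: "int \<Rightarrow> bool"
  assumes "\<And>a b c. T (med3 a b c) \<Longrightarrow> (T a \<and> T b) \<or> (T a \<and> T c) \<or> (T b \<and> T c)"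
    and "9 * g \<le> m"
  shows "4 * length (filter (\<lambda>q. T (ninther (\<lambda>r. f (9 * q + r)))) [0..<g])
    \<le> length (filter (\<lambda>i. T (f i)) [0..<m])"
proof -
  have "4 * length (filter (\<lambda>q. T (ninther (\<lambda>r. f (9 * q + r)))) [0..<g])
    \<le> length (filter (\<lambda>i. T (f i)) [0..<9 * g])"
  proof (induction g)
    case (Suc g)
    have "[9 * g..<9 * g + 9] = map (\<lambda>r. 9 * g + r) [0..<9]"
      using map_add_upt[of "9 * g" 9] by (simp add: add.commute)
    then have "[0..<9 * Suc g] = [0..<9 * g] @ map (\<lambda>r. 9 * g + r) [0..<9]"
      using upt_add_eq_append[of 0 "9 * g" 9] by (simp add: add.commute)
    moreover have "T (ninther (\<lambda>r. f (9 * g + r))) \<Longrightarrow>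
        4 \<le> length (filter (\<lambda>r. T (f (9 * g + r))) [0..<9])"
      using assms(1) by (rule ninther_majority)
    ultimately show ?case
      using Suc.IH by (auto simp: filter_map o_def)
  qed simp
  moreover have "[0..<m] = [0..<9 * g] @ [9 * g..<m]"
    using upt_add_eq_append[of 0 "9 * g" "m - 9 * g"] assms(2) by simp
  ultimately show ?thesis
    by simp
qed

text \<open>With all costs 2 and budget \<open>g\<close>, a threshold is a median of the
  \<open>g\<close> ninthers. At least half of them lie on either weak side of \<open>p\<close>, each
  backed by four keys, so at least \<open>2 * g\<close> keys are at most \<open>p\<close> and at
  least \<open>2 * g\<close> are at least \<open>p\<close>. These are missing from the opposite
  strict side.\<close>

lemma pivot_balanced:
  assumes "is_threshold (map (\<lambda>q. (ninther (\<lambda>r. f (9 * q + r)), 2)) [0..<g]) (int g) p"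
    and "9 * g \<le> m"
  shows "length (filter (\<lambda>i. f i < p) [0..<m]) \<le> m - 2 * g"
    and "length (filter (\<lambda>i. p < f i) [0..<m]) \<le> m - 2 * g"
proof -
  let ?v = "\<lambda>q. ninther (\<lambda>r. f (9 * q + r))"
  have tot: "cost_sum (filter Q (map (\<lambda>q. (?v q, 2)) xs)) = 2 * int (length (filter (\<lambda>q. Q (?v q, 2)) xs))"
    for Q xs by (induction xs) auto
  have compl: "length (filter Q xs) + length (filter (\<lambda>x. \<not> Q x) xs) = length xs" for Q and xs :: "nat list"
    by (rule sum_length_filter_compl)
  have "2 * length (filter (\<lambda>q. ?v q < p) [0..<g]) \<le> g" "g < 2 * length (filter (\<lambda>q. ?v q \<le> p) [0..<g])"
    using assms(1) unfolding is_threshold_def tot by simp_all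
  moreover have "length (filter (\<lambda>q. ?v q < p) [0..<g]) + length (filter (\<lambda>q. p \<le> ?v q) [0..<g]) = g"
    using compl[of "\<lambda>q. ?v q < p" "[0..<g]"] by (simp add: not_less)
  moreover have "4 * length (filter (\<lambda>q. ?v q \<le> p) [0..<g]) \<le> length (filter (\<lambda>i. f i \<le> p) [0..<m])"
    by (rule ninthers_majority[OF _ assms(2)]) (auto simp: med3_def)
  moreover have "4 * length (filter (\<lambda>q. p \<le> ?v q) [0..<g]) \<le> length (filter (\<lambda>i. p \<le> f i) [0..<m])"
    by (rule ninthers_majority[OF _ assms(2)]) (auto simp: med3_def le_max_iff_disj)
  moreover have "length (filter (\<lambda>i. f i < p) [0..<m]) + length (filter (\<lambda>i. p \<le> f i) [0..<m]) = m"
    using compl[of "\<lambda>i. f i < p" "[0..<m]"] by (simp add: not_less)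
  moreover have "length (filter (\<lambda>i. f i \<le> p) [0..<m]) + length (filter (\<lambda>i. p < f i) [0..<m]) = m"
    using compl[of "\<lambda>i. f i \<le> p" "[0..<m]"] by (simp add: not_le)
  ultimately show "length (filter (\<lambda>i. f i < p) [0..<m]) \<le> m - 2 * g"
    "length (filter (\<lambda>i. p < f i) [0..<m]) \<le> m - 2 * g"
    by linarith+
qed

section \<open>Selecting a threshold\<close>

abbreviation Var :: "vname \<Rightarrow> aexp" where
  "Var a \<equiv> Cell a (Const 0)"

abbreviation Set_var :: "vname \<Rightarrow> aexp \<Rightarrow> com" where
  "Set_var a e \<equiv> Assign a (Const 0) e"

abbreviation Incr :: "vname \<Rightarrow> int \<Rightarrow> com" where
  "Incr a k \<equiv> Set_var a (Add (Var a) (Const k))"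

abbreviation Then :: "com \<Rightarrow> com \<Rightarrow> com" (infixr ";;" 60) where
  "c ;; d \<equiv> Seq c d"

text \<open>Array \<open>k\<close> holds the keys and \<open>u\<close> the costs. This list view
  links the memory to \<open>is_threshold\<close>.\<close>

definition seg :: "state \<Rightarrow> int \<Rightarrow> nat \<Rightarrow> (int \<times> int) list" where
  "seg s l m = map (\<lambda>i. (s ''k'' (l + int i), s ''u'' (l + int i))) [0..<m]"

lemma seg_0 [simp]: "seg s l 0 = []"
  by (simp add: seg_def)

lemma seg_Suc: "seg s l (Suc m) = seg s l m @ [(s ''k'' (l + int m), s ''u'' (l + int m))]"
  by (simp add: seg_def)

lemma length_seg [simp]: "length (seg s l m) = m"
  by (simp add: seg_def)

lemma seg_cong:
  assumes "\<And>i. l \<le> i \<Longrightarrow> i < l + int m \<Longrightarrow> s ''k'' i = s' ''k'' i \<and> s ''u'' i = s' ''u'' i"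
  shows "seg s l m = seg s' l m"
  unfolding seg_def using assms by (intro map_cong) auto

section \<open>Computing the ninthers\<close>

definition set_med3 :: "vname \<Rightarrow> aexp \<Rightarrow> aexp \<Rightarrow> aexp \<Rightarrow> com" where
  "set_med3 d a b c =
     If (Less a b)
       (If (Less b c) (Set_var d b) (If (Less a c) (Set_var d c) (Set_var d a)))
       (If (Less a c) (Set_var d a) (If (Less b c) (Set_var d c) (Set_var d b)))"

lemma straight_set_med3 [simp]: "straight (set_med3 d a b c)"
  by (simp add: set_med3_def)

lemma effect_set_med3 [simp]:
  "effect (set_med3 d a b c) s = s(d := (s d)(0 := med3 (aval a s) (aval b s) (aval c s)))"
proof -
  have "effect (set_med3 d a b c) s = s(d := (s d)(0 :=
    (if aval a s < aval b s
     then if aval b s < aval c s then aval b s else if aval a s < aval c s then aval c s else aval a s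
     else if aval a s < aval c s then aval a s else if aval b s < aval c s then aval c s else aval b s)))"
    by (simp add: set_med3_def)
  also have "\<dots> = s(d := (s d)(0 := med3 (aval a s) (aval b s) (aval c s)))"
    by (simp add: med3_def max_def min_def)
  finally show ?thesis .
qed

abbreviation key_at :: "int \<Rightarrow> aexp" where
  "key_at r \<equiv> Cell ''k'' (Add (Var ''i'') (Const r))"

text \<open>The cost 2 with budget \<open>g\<close> stands for cost 1 with budget \<open>g / 2\<close>: the machine cannot halve.\<close>

definition ninther_step :: com where
  "ninther_step =
     set_med3 ''m0'' (key_at 0) (key_at 1) (key_at 2) ;;
     set_med3 ''m1'' (key_at 3) (key_at 4) (key_at 5) ;;
     set_med3 ''m2'' (key_at 6) (key_at 7) (key_at 8) ;;
     set_med3 ''m0'' (Var ''m0'') (Var ''m1'') (Var ''m2'') ;;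
     Assign ''k'' (Var ''j'') (Var ''m0'') ;;
     Assign ''u'' (Var ''j'') (Const 2) ;;
     Incr ''j'' 1 ;;
     Incr ''i'' 9"

text \<open>The offset 8 admits full blocks only; the last \<open>m mod 9\<close> items yield no
  ninther.\<close>

definition ninther_loop :: com where
  "ninther_loop = While (Less (Add (Var ''i'') (Const 8)) (Var ''hi'')) ninther_step"

lemma effect_ninther_step:
  assumes "s ''i'' 0 = l"
  shows "effect ninther_step s ''k'' = (s ''k'')(s ''j'' 0 := ninther (\<lambda>r. s ''k'' (l + int r)))"
    and "effect ninther_step s ''u'' = (s ''u'')(s ''j'' 0 := 2)"
    and "effect ninther_step s ''j'' 0 = s ''j'' 0 + 1"
    and "effect ninther_step s ''i'' 0 = l + 9"
    and "a \<notin> {''i'', ''j'', ''k'', ''u'', ''m0'', ''m1'', ''m2''} \<Longrightarrow> effect ninther_step s a = s a"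
  using assms by (simp_all add: ninther_step_def ninther_def add.commute)

text \<open>The ninthers are written beyond the segment, so the keys being read survive. One index
  is skipped because position \<open>hi\<close> of the save arrays has to lie below the segment of
  the recursive call.\<close>

lemma runs_ninther_loop:
  assumes "s ''i'' 0 = l" "s ''hi'' 0 = l + int m" "s ''j'' 0 = l + int m + 1"
  shows "runs P ninther_loop s (500 * (m + 1)) (\<lambda>s'.
    (\<forall>a. a \<notin> {''i'', ''j'', ''k'', ''u'', ''m0'', ''m1'', ''m2''} \<longrightarrow> s' a = s a) \<and>
    s' ''j'' 0 = l + int m + 1 + int (m div 9) \<and>
    (\<forall>i<l + int m + 1. s' ''k'' i = s ''k'' i \<and> s' ''u'' i = s ''u'' i) \<and>
    seg s' (l + int m + 1) (m div 9) =
      map (\<lambda>q. (ninther (\<lambda>r. s ''k'' (l + int (9 * q + r))), 2)) [0..<m div 9])"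
  unfolding ninther_loop_def
proof (rule runs_While[where n = "m div 9" and I = "\<lambda>q s'.
    (\<forall>a. a \<notin> {''i'', ''j'', ''k'', ''u'', ''m0'', ''m1'', ''m2''} \<longrightarrow> s' a = s a) \<and>
    s' ''i'' 0 = l + 9 * int q \<and> s' ''j'' 0 = l + int m + 1 + int q \<and>
    (\<forall>i<l + int m + 1. s' ''k'' i = s ''k'' i \<and> s' ''u'' i = s ''u'' i) \<and>
    seg s' (l + int m + 1) q =
      map (\<lambda>q. (ninther (\<lambda>r. s ''k'' (l + int (9 * q + r))), 2)) [0..<q]"], goal_cases)
  case 1
  show ?case by (simp add: ninther_step_def)
next
  case 2
  show ?case using assms by simp
next
  case (3 q s')
  let ?s = "effect ninther_step s'"
  from 3 have i: "s' ''i'' 0 = l + 9 * int q" and j: "s' ''j'' 0 = l + int m + 1 + int q"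
    and hi: "s' ''hi'' 0 = l + int m"
    using assms by auto
  note eff = effect_ninther_step[where s = s', OF i, unfolded j]
  have less: "9 * q + 9 \<le> m"
    using 3(1) by presburger
  have seg: "seg ?s (l + int m + 1) q = seg s' (l + int m + 1) q"
    by (rule seg_cong) (simp add: eff)
  \<comment> \<open>The block ends before \<open>l + int m\<close>, where the keys are still the
    original ones.\<close>
  have "ninther (\<lambda>r. s' ''k'' (l + 9 * int q + int r)) = ninther (\<lambda>r. s ''k'' (l + int (9 * q + r)))"
    using 3 less by (simp add: ninther_def algebra_simps)
  then have "seg ?s (l + int m + 1) (Suc q) =
      map (\<lambda>q. (ninther (\<lambda>r. s ''k'' (l + int (9 * q + r))), 2)) [0..<Suc q]"
    using 3 by (simp add: seg_Suc seg eff)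
  then show ?case
    using 3 less i hi by (auto simp: eff)
next
  case (4 s')
  have "m < 9 * (m div 9) + 9"
    by presburger
  with 4 assms show ?case by auto
next
  case 5
  have "(m div 9 + 1) * 500 \<le> 500 * (m + 1)"
    by simp
  moreover have "bcost (Less (Add (Var ''i'') (Const 8)) (Var ''hi'')) + 1 + ccost ninther_step \<le> 500"
    by (simp add: ninther_step_def set_med3_def)
  ultimately show ?case
    by (meson le_trans mult_le_mono2)
qed

section \<open>Splitting a segment around the pivot\<close>

definition sums_loop :: com where
  "sums_loop =
     While (Less (Var ''i'') (Var ''hi''))
       (If (Less (Cell ''k'' (Var ''i'')) (Var ''p''))
          (Set_var ''L'' (Add (Var ''L'') (Cell ''u'' (Var ''i''))))
          (If (Eq (Cell ''k'' (Var ''i'')) (Var ''p''))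
             (Set_var ''E'' (Add (Var ''E'') (Cell ''u'' (Var ''i''))))
             Skip) ;;
        Incr ''i'' 1)"

text \<open>\<open>L\<close> and \<open>E\<close> together tell whether the budget runs out below,
  at or above the pivot.\<close>

lemma runs_sums_loop:
  assumes "s ''i'' 0 = l" "s ''hi'' 0 = l + int m" "s ''L'' 0 = 0" "s ''E'' 0 = 0"
  shows "runs P sums_loop s (100 * (m + 1)) (\<lambda>s'.
    (\<forall>a. a \<notin> {''i'', ''L'', ''E''} \<longrightarrow> s' a = s a) \<and>
    s' ''L'' 0 = cost_sum (filter (\<lambda>x. fst x < s ''p'' 0) (seg s l m)) \<and>
    s' ''E'' 0 = cost_sum (filter (\<lambda>x. fst x = s ''p'' 0) (seg s l m)))"
  unfolding sums_loop_def
  by (rule runs_While[where n = m and I = "\<lambda>t s'.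
    (\<forall>a. a \<notin> {''i'', ''L'', ''E''} \<longrightarrow> s' a = s a) \<and>
    s' ''i'' 0 = l + int t \<and>
    s' ''L'' 0 = cost_sum (filter (\<lambda>x. fst x < s ''p'' 0) (seg s l t)) \<and>
    s' ''E'' 0 = cost_sum (filter (\<lambda>x. fst x = s ''p'' 0) (seg s l t))"])
    (use assms in \<open>auto simp: seg_Suc\<close>)

definition retain :: "bexp \<Rightarrow> com" where
  "retain test =
     (Set_var ''i'' (Var ''lo'') ;; Set_var ''j'' (Var ''lo'')) ;;
     While (Less (Var ''i'') (Var ''hi''))
       (If test
          (Assign ''k'' (Var ''j'') (Cell ''k'' (Var ''i'')) ;;
           Assign ''u'' (Var ''j'') (Cell ''u'' (Var ''i'')) ;;
           Incr ''j'' 1)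
          Skip ;;
        Incr ''i'' 1) ;;
     Set_var ''hi'' (Var ''j'')"

text \<open>Filtering in place: the write index never overtakes the read index, so each item is read
  before its cell is overwritten. The relation \<open>Q\<close> covers both sides of the
  pivot.\<close>

lemma runs_retain:
  assumes lo: "s ''lo'' 0 = l" and hi: "s ''hi'' 0 = l + int m"
    and test: "\<And>s. bval test s \<longleftrightarrow> Q (s ''p'' 0) (s ''k'' (s ''i'' 0))"
    and cost: "bcost test \<le> 10"
  defines "ys \<equiv> filter (\<lambda>x. Q (s ''p'' 0) (fst x)) (seg s l m)"
  shows "runs P (retain test) s (100 * (m + 1)) (\<lambda>s'.
    (\<forall>a. a \<notin> {''i'', ''j'', ''k'', ''u'', ''hi''} \<longrightarrow> s' a = s a) \<and>
    s' ''hi'' 0 = l + int (length ys) \<and> seg s' l (length ys) = ys \<and>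
    (\<forall>i<l. s' ''k'' i = s ''k'' i \<and> s' ''u'' i = s ''u'' i))"
proof -
  define F where "F t = filter (\<lambda>x. Q (s ''p'' 0) (fst x)) (seg s l t)" for t
  \<comment> \<open>This keeps the write index \<open>l + length (F t)\<close> at or below the read
    index \<open>l + t\<close>.\<close>
  have F_le: "length (F t) \<le> t" for t
    unfolding F_def by (metis length_filter_le length_seg)
  define I where "I t s' \<longleftrightarrow>
    (\<forall>a. a \<notin> {''i'', ''j'', ''k'', ''u''} \<longrightarrow> s' a = s a) \<and>
    s' ''i'' 0 = l + int t \<and> s' ''j'' 0 = l + int (length (F t)) \<and>
    seg s' l (length (F t)) = F t \<and>
    (\<forall>i. i < l \<or> l + int t \<le> i \<longrightarrow> s' ''k'' i = s ''k'' i \<and> s' ''u'' i = s ''u'' i)" for t s'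
  let ?body = "If test
          (Assign ''k'' (Var ''j'') (Cell ''k'' (Var ''i'')) ;;
           Assign ''u'' (Var ''j'') (Cell ''u'' (Var ''i'')) ;;
           Incr ''j'' 1)
          Skip ;;
        Incr ''i'' 1"
  have step: "I (Suc t) (effect ?body s')" if "I t s'" for t s'
  proof (cases "Q (s ''p'' 0) (s ''k'' (l + int t))")
    case True
    then have F: "F (Suc t) = F t @ [(s ''k'' (l + int t), s ''u'' (l + int t))]"
      by (simp add: F_def seg_Suc)
    have b: "bval test s'"
      using that True by (simp add: test I_def)
    have "seg (effect ?body s') l (length (F t)) = seg s' l (length (F t))"
      using that b by (intro seg_cong) (auto simp: I_def)
    then have "seg (effect ?body s') l (length (F (Suc t))) = F (Suc t)"
      using that b F_le[of t] by (simp add: F seg_Suc I_def)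
    then show ?thesis
      using that b F_le[of t] unfolding I_def by (simp add: F)
  next
    case False
    then have F: "F (Suc t) = F t"
      by (simp add: F_def seg_Suc)
    have b: "\<not> bval test s'"
      using that False by (simp add: test I_def)
    have "seg (effect ?body s') l (length (F t)) = seg s' l (length (F t))"
      using that b by (intro seg_cong) (auto simp: I_def)
    then show ?thesis
      using that b unfolding I_def by (simp add: F)
  qed
  have loop: "runs P (While (Less (Var ''i'') (Var ''hi'')) ?body) s' (80 * (m + 1)) (I m)"
    if "I 0 s'" for s'
  proof (rule runs_While[where n = m and I = I])
    show "bval (Less (Var ''i'') (Var ''hi'')) s'' \<and> I (Suc t) (effect ?body s'')"
      if "t < m" "I t s''" for t s''
      using that step[OF that(2)] hi by (simp add: I_def del: effect.simps)
    show "\<not> bval (Less (Var ''i'') (Var ''hi'')) s'' \<and> I m s''" if "I m s''" for s''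
      using that hi by (simp add: I_def)
    have "bcost (Less (Var ''i'') (Var ''hi'')) + 1 + ccost ?body \<le> 80"
      using cost by simp
    then show "(m + 1) * (bcost (Less (Var ''i'') (Var ''hi'')) + 1 + ccost ?body) \<le> 80 * (m + 1)"
      by (metis mult.commute mult_le_mono2)
  qed (use that in simp_all)
  have init: "I 0 (effect (Set_var ''i'' (Var ''lo'') ;; Set_var ''j'' (Var ''lo'')) s)"
    using lo by (simp add: I_def F_def)
  have ys: "ys = F m"
    by (simp add: ys_def F_def)
  have last: "runs P (Set_var ''hi'' (Var ''j'')) s' 4 (\<lambda>s'.
    (\<forall>a. a \<notin> {''i'', ''j'', ''k'', ''u'', ''hi''} \<longrightarrow> s' a = s a) \<and>
    s' ''hi'' 0 = l + int (length ys) \<and> seg s' l (length ys) = ys \<and>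
    (\<forall>i<l. s' ''k'' i = s ''k'' i \<and> s' ''u'' i = s ''u'' i))" if "I m s'" for s'
    using that by (intro runs_straight) (auto simp: I_def ys seg_def)
  show ?thesis
    unfolding retain_def
  proof (rule runs_Seq[where t = 8 and t' = "80 * (m + 1) + 4" and R = "I 0"])
    show "runs P (Set_var ''i'' (Var ''lo'') ;; Set_var ''j'' (Var ''lo'')) s 8 (I 0)"
      using init by (intro runs_straight) simp_all
  qed (rule runs_Seq[OF loop last], simp_all)
qed

text \<open>The segment from \<open>lo\<close> to \<open>hi\<close> is the top of a stack. Cell \<open>hi\<close> of \<open>slo\<close> and \<open>sb\<close> saves \<open>lo\<close> and
  \<open>b\<close>, and the recursive call works on the cells from \<open>hi + 1\<close> on. It restores its own \<open>lo\<close>, from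
  which the old \<open>hi\<close> is recovered.\<close>

definition choose_pivot :: com where
  "choose_pivot =
     (Set_var ''i'' (Var ''lo'') ;; Set_var ''j'' (Add (Var ''hi'') (Const 1))) ;;
     ninther_loop ;;
     If (Eq (Var ''j'') (Add (Var ''hi'') (Const 1)))
       (Set_var ''p'' (Cell ''k'' (Var ''lo'')))
       ((Assign ''slo'' (Var ''hi'') (Var ''lo'') ;;
         Assign ''sb'' (Var ''hi'') (Var ''b'') ;;
         Set_var ''lo'' (Add (Var ''hi'') (Const 1)) ;;
         Set_var ''hi'' (Var ''j'') ;;
         Set_var ''b'' (Sub (Var ''hi'') (Var ''lo''))) ;;
        Call 0 ;;
        (Set_var ''hi'' (Sub (Var ''lo'') (Const 1)) ;;
         Set_var ''b'' (Cell ''sb'' (Var ''hi'')) ;;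
         Set_var ''lo'' (Cell ''slo'' (Var ''hi''))))"

definition find_threshold :: com where
  "find_threshold =
     choose_pivot ;;
     ((Set_var ''i'' (Var ''lo'') ;; Set_var ''L'' (Const 0) ;; Set_var ''E'' (Const 0)) ;;
      sums_loop) ;;
     If (Less (Var ''b'') (Var ''L''))
       (retain (Less (Cell ''k'' (Var ''i'')) (Var ''p'')) ;; Call 0)
       (If (Less (Var ''b'') (Add (Var ''L'') (Var ''E'')))
          Skip
          (Set_var ''b'' (Sub (Var ''b'') (Add (Var ''L'') (Var ''E''))) ;;
           retain (Less (Var ''p'') (Cell ''k'' (Var ''i''))) ;; Call 0))"

section \<open>Correctness and linear time of the recursion\<close>

definition instance_at :: "state \<Rightarrow> int \<Rightarrow> int \<Rightarrow> (int \<times> int) list \<Rightarrow> bool" where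
  "instance_at s l b xs \<longleftrightarrow>
     s ''lo'' 0 = l \<and> s ''hi'' 0 = l + int (length xs) \<and>
     seg s l (length xs) = xs \<and> s ''b'' 0 = b"

text \<open>What a call leaves intact: input, output, and all stack cells below its segment.
  \<open>hi\<close> and \<open>b\<close> are absent because the search overwrites them;
  \<open>lo\<close> suffices for the caller to locate its saved values at index
  \<open>lo - 1\<close>.\<close>

definition frame :: "int \<Rightarrow> state \<Rightarrow> state \<Rightarrow> bool" where
  "frame l s s' \<longleftrightarrow>
     (\<forall>a\<in>{''n'', ''B'', ''x'', ''w'', ''c'', ''phi''}. s' a = s a) \<and> s' ''lo'' 0 = s ''lo'' 0 \<and>
     (\<forall>a\<in>{''k'', ''u'', ''slo'', ''sb''}. \<forall>i<l. s' a i = s a i)"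

lemma frame_trans: "frame l s s' \<Longrightarrow> frame l s' s'' \<Longrightarrow> frame l s s''"
  by (simp add: frame_def)

text \<open>A bound on the items left after one round. Below nine items the pivot is simply the
  first key, and only that item is sure to go.\<close>

definition pruned_size :: "nat \<Rightarrow> nat" where
  "pruned_size m = (if m div 9 = 0 then m - 1 else m - 2 * (m div 9))"

text \<open>\<open>IH\<close> is the induction hypothesis of the whole search, applied here to the
  list of ninthers, which is shorter than \<open>xs\<close>.\<close>

lemma runs_choose_pivot:
  assumes inst: "instance_at s l b xs" and "xs \<noteq> []"
    and IH: "\<And>s l b ys. length ys < length xs \<Longrightarrow> instance_at s l b ys \<Longrightarrow> 0 \<le> b \<Longrightarrow> b < cost_sum ys \<Longrightarrow>
      runs P (Call 0) s (K * length ys) (\<lambda>s'. is_threshold ys b (s' ''p'' 0) \<and> frame l s s')"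
  shows "runs P choose_pivot s (600 * (length xs + 1) + K * (length xs div 9)) (\<lambda>s'.
    instance_at s' l b xs \<and> frame l s s' \<and>
    length (filter (\<lambda>x. fst x < s' ''p'' 0) xs) \<le> pruned_size (length xs) \<and>
    length (filter (\<lambda>x. s' ''p'' 0 < fst x) xs) \<le> pruned_size (length xs))"
proof -
  define m where "m = length xs"
  define g where "g = m div 9"
  have m: "m > 0"
    using assms(2) by (simp add: m_def)
  define f where "f i = s ''k'' (l + int i)" for i
  have lo: "s ''lo'' 0 = l" and hi: "s ''hi'' 0 = l + int m" and b: "s ''b'' 0 = b"
    and xs: "xs = seg s l m"
    using inst by (simp_all add: instance_at_def m_def)
  have len: "length (filter (\<lambda>x. Q (fst x)) xs) = length (filter (\<lambda>i. Q (f i)) [0..<m])" for Q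
    by (simp add: xs seg_def filter_map o_def f_def)
  define ys where "ys = map (\<lambda>q. (ninther (\<lambda>r. f (9 * q + r)), 2 :: int)) [0..<g]"
  have cost_sum_ys: "cost_sum ys = 2 * int g"
    unfolding ys_def by (induction g) auto
  define R where "R s' \<longleftrightarrow>
    (\<forall>a. a \<notin> {''i'', ''j'', ''k'', ''u'', ''m0'', ''m1'', ''m2''} \<longrightarrow> s' a = s a) \<and>
    s' ''j'' 0 = l + int m + 1 + int g \<and>
    (\<forall>i<l + int m + 1. s' ''k'' i = s ''k'' i \<and> s' ''u'' i = s ''u'' i) \<and>
    seg s' (l + int m + 1) g = ys" for s'
  let ?Q = "\<lambda>s'. instance_at s' l b xs \<and> frame l s s' \<and>
    length (filter (\<lambda>x. fst x < s' ''p'' 0) xs) \<le> pruned_size m \<and>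
    length (filter (\<lambda>x. s' ''p'' 0 < fst x) xs) \<le> pruned_size m"
  let ?init = "Set_var ''i'' (Var ''lo'') ;; Set_var ''j'' (Add (Var ''hi'') (Const 1))"
  have loop: "runs P ninther_loop (effect ?init s) (500 * (m + 1)) R"
    by (rule runs_mono[OF runs_ninther_loop[where l = l and m = m]])
      (simp_all add: lo hi R_def g_def ys_def f_def)
  let ?save = "Assign ''slo'' (Var ''hi'') (Var ''lo'') ;;
         Assign ''sb'' (Var ''hi'') (Var ''b'') ;;
         Set_var ''lo'' (Add (Var ''hi'') (Const 1)) ;;
         Set_var ''hi'' (Var ''j'') ;;
         Set_var ''b'' (Sub (Var ''hi'') (Var ''lo''))"
  let ?restore = "Set_var ''hi'' (Sub (Var ''lo'') (Const 1)) ;;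
         Set_var ''b'' (Cell ''sb'' (Var ''hi'')) ;;
         Set_var ''lo'' (Cell ''slo'' (Var ''hi''))"
  have small: "runs P (Set_var ''p'' (Cell ''k'' (Var ''lo''))) s' 50 ?Q" if "R s'" "g = 0" for s'
  proof (rule runs_straight)
    let ?s = "effect (Set_var ''p'' (Cell ''k'' (Var ''lo''))) s'"
    have p: "?s ''p'' 0 = f 0"
      using that m by (simp add: R_def lo f_def)
    have "seg ?s l m = xs"
      unfolding xs using that by (intro seg_cong) (simp add: R_def)
    then have inst': "instance_at ?s l b xs"
      using that lo hi b by (simp add: instance_at_def R_def m_def)
    have fr: "frame l s ?s"
      using that by (auto simp: frame_def R_def)
    \<comment> \<open>\<open>Q\<close> will be a strict comparison with \<open>f 0\<close>, which
      fails at index 0.\<close>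
    have "length (filter Q [0..<m]) \<le> m - 1" if "\<not> Q 0" for Q
    proof -
      have "[0..<m] = 0 # [1..<m]"
        using m by (simp add: upt_rec)
      then have "length (filter Q [0..<m]) = length (filter Q [1..<m])"
        using that by simp
      also have "\<dots> \<le> m - 1"
        by (metis length_filter_le length_upt)
      finally show ?thesis .
    qed
    from this[of "\<lambda>i. f i < f 0"] this[of "\<lambda>i. f 0 < f i"]
    show "?Q ?s"
      using inst' fr \<open>g = 0\<close> unfolding p len[of "\<lambda>y. y < f 0"] len[of "\<lambda>y. f 0 < y"]
      by (simp add: pruned_size_def g_def)
  qed simp_all
  have restore: "runs P ?restore s'' 30 ?Q"
    if "g > 0" "R s'" "is_threshold ys (int g) (s'' ''p'' 0)"
      and fr: "frame (l + int m + 1) (effect ?save s') s''" for s' s''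
  proof (rule runs_straight)
    let ?s = "effect ?restore s''"
    \<comment> \<open>The saved values sit at index \<open>l + m\<close>, just below the segment of
      the call, so \<open>frame\<close> protects them.\<close>
    have lo'': "s'' ''lo'' 0 = l + int m + 1" "s'' ''slo'' (l + int m) = l" "s'' ''sb'' (l + int m) = b"
      using fr that(2) lo hi b by (auto simp: frame_def R_def)
    have ku: "s'' ''k'' i = s ''k'' i \<and> s'' ''u'' i = s ''u'' i" if "i < l + int m + 1" for i
      using fr \<open>R s'\<close> that by (auto simp: frame_def R_def)
    have "seg ?s l m = xs"
      unfolding xs by (intro seg_cong) (simp add: ku)
    then have inst': "instance_at ?s l b xs"
      by (simp add: instance_at_def lo'' m_def[symmetric])
    have fr': "frame l s ?s"
      using fr \<open>R s'\<close> lo hi lo'' by (auto simp: frame_def R_def)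
    have "9 * g \<le> m"
      by (simp add: g_def)
    from pivot_balanced[OF that(3)[unfolded ys_def] this]
    show "?Q ?s"
      using inst' fr' \<open>g > 0\<close> len[of "\<lambda>y. y < s'' ''p'' 0"] len[of "\<lambda>y. s'' ''p'' 0 < y"]
      by (simp add: pruned_size_def g_def)
  qed simp_all
  have large: "runs P (?save ;; Call 0 ;; ?restore) s' (80 + K * g) ?Q" if "R s'" "g > 0" for s'
  proof -
    \<comment> \<open>The new budget \<open>hi - lo\<close> equals \<open>g\<close>, half of the
      total cost \<open>2 * g\<close>; as \<open>g > 0\<close>, it is below that total.\<close>
    have inst': "instance_at (effect ?save s') (l + int m + 1) (int g) ys"
    proof -
      have "seg (effect ?save s') (l + int m + 1) g = seg s' (l + int m + 1) g"
        by (rule seg_cong) simp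
      then show ?thesis
        using that hi by (simp add: instance_at_def R_def ys_def)
    qed
    have "length ys < length xs"
      using m by (simp add: ys_def g_def m_def[symmetric])
    from IH[OF this inst'] have call: "runs P (Call 0) (effect ?save s') (K * g)
        (\<lambda>s''. is_threshold ys (int g) (s'' ''p'' 0) \<and> frame (l + int m + 1) (effect ?save s') s'')"
      using that(2) cost_sum_ys by (simp add: ys_def)
    have "runs P (Call 0 ;; ?restore) (effect ?save s') (K * g + 30) ?Q"
      by (rule runs_Seq[OF call restore]) (use that in auto)
    then show ?thesis
      by (rule runs_straight_Seq[rotated]) simp_all
  qed
  have main: "runs P (If (Eq (Var ''j'') (Add (Var ''hi'') (Const 1)))
       (Set_var ''p'' (Cell ''k'' (Var ''lo'')))
       (?save ;; Call 0 ;; ?restore)) s' (90 + K * g) ?Q" if "R s'" for s'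
  proof (rule runs_If[where t = "80 + K * g"])
    assume "bval (Eq (Var ''j'') (Add (Var ''hi'') (Const 1))) s'"
    with that hi have "g = 0"
      by (simp add: R_def)
    with small[OF that] show "runs P (Set_var ''p'' (Cell ''k'' (Var ''lo''))) s' (80 + K * g) ?Q"
      by (auto intro: runs_mono)
  next
    assume "\<not> bval (Eq (Var ''j'') (Add (Var ''hi'') (Const 1))) s'"
    with that hi have "g > 0"
      by (simp add: R_def)
    with large[OF that] show "runs P (?save ;; Call 0 ;; ?restore) s' (80 + K * g) ?Q" .
  qed simp
  have "runs P (ninther_loop ;; If (Eq (Var ''j'') (Add (Var ''hi'') (Const 1)))
       (Set_var ''p'' (Cell ''k'' (Var ''lo'')))
       (?save ;; Call 0 ;; ?restore)) (effect ?init s) (500 * (m + 1) + (90 + K * g)) ?Q"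
    by (rule runs_Seq[OF loop main]) simp_all
  then show ?thesis
    unfolding choose_pivot_def m_def[symmetric] g_def[symmetric]
    by (rule runs_straight_Seq[rotated]) simp_all
qed

text \<open>The summands are: building the ninthers and selecting their median, summing the costs,
  compacting, and recursing on \<open>m'\<close> items. The subtracted unit pays for the
  \<open>Call\<close>.\<close>

lemma time_recurrence:
  assumes "m > 0" "m' \<le> pruned_size m"
  shows "600 * (m + 1) + 34000 * (m div 9) +
    (100 * (m + 1) + 12 + (100 * (m + 1) + 34000 * m' + 50)) \<le> 34000 * m - 1"
proof -
  define g where "g = m div 9"
  have g: "9 * g \<le> m" "m < 9 * g + 9"
    unfolding g_def by (simp_all add: dividend_less_times_div)
  \<comment> \<open>For \<open>g > 0\<close> the two recursive calls handle at most
    \<open>m - g\<close> items, which saves \<open>34000 * g\<close>. The remaining work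
    \<open>800 * (m + 1) + 62\<close> is at most \<open>7200 * g + 7262\<close>. For
    \<open>g = 0\<close> one item is saved and \<open>m \<le> 8\<close>.\<close>
  have m': "m' \<le> (if g = 0 then m - 1 else m - 2 * g)"
    using assms(2) unfolding pruned_size_def g_def .
  show ?thesis
    unfolding g_def[symmetric] using g m' assms(1) by (cases "g = 0") simp_all
qed

text \<open>Strong induction on the number of items. The condition that \<open>b\<close> is
  nonnegative and below the total cost is inherited by every recursive call.\<close>

lemma runs_find_threshold:
  assumes "instance_at s l b xs" "0 \<le> b" "b < cost_sum xs"
  shows "runs [find_threshold] (Call 0) s (34000 * length xs)
    (\<lambda>s'. is_threshold xs b (s' ''p'' 0) \<and> frame l s s')"
  using assms
proof (induction "length xs" arbitrary: s l b xs rule: less_induct)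
  case less
  let ?P = "[find_threshold]" and ?m = "length xs"
  let ?Q = "\<lambda>s'. is_threshold xs b (s' ''p'' 0) \<and> frame l s s'"
  have "xs \<noteq> []"
    using less.prems by auto
  then have m: "?m > 0"
    by simp
  let ?R1 = "\<lambda>s'. instance_at s' l b xs \<and> frame l s s' \<and>
    length (filter (\<lambda>x. fst x < s' ''p'' 0) xs) \<le> pruned_size ?m \<and>
    length (filter (\<lambda>x. s' ''p'' 0 < fst x) xs) \<le> pruned_size ?m"
  let ?R2 = "\<lambda>s'. ?R1 s' \<and>
    s' ''L'' 0 = cost_sum (filter (\<lambda>x. fst x < s' ''p'' 0) xs) \<and>
    s' ''E'' 0 = cost_sum (filter (\<lambda>x. fst x = s' ''p'' 0) xs)"
  have pruned_less: "pruned_size ?m < ?m"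
    using m by (auto simp: pruned_size_def)
  define N where "N = 34000 * pruned_size ?m"
  have pivot: "runs ?P choose_pivot s (600 * (?m + 1) + 34000 * (?m div 9)) ?R1"
    by (rule runs_choose_pivot[OF less.prems(1) \<open>xs \<noteq> []\<close>]) (use less.hyps in blast)
  have sums: "runs ?P ((Set_var ''i'' (Var ''lo'') ;; Set_var ''L'' (Const 0) ;; Set_var ''E'' (Const 0)) ;;
      sums_loop) s' (100 * (?m + 1) + 12) ?R2" if "?R1 s'" for s'
  proof (rule runs_straight_Seq)
    define s'' where "s'' = effect (Set_var ''i'' (Var ''lo'') ;; Set_var ''L'' (Const 0) ;; Set_var ''E'' (Const 0)) s'"
    have "seg s'' l ?m = xs"
      using that by (simp add: s''_def seg_def instance_at_def)
    with that have "runs ?P sums_loop s'' (100 * (?m + 1)) ?R2"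
      by (intro runs_mono[OF runs_sums_loop[where l = l and m = ?m]])
        (auto simp: s''_def instance_at_def frame_def seg_def)
    then show "runs ?P sums_loop (effect (Set_var ''i'' (Var ''lo'') ;; Set_var ''L'' (Const 0) ;;
        Set_var ''E'' (Const 0)) s') (100 * (?m + 1)) ?R2"
      unfolding s''_def .
  qed simp_all
  have call: "runs ?P (Call 0) s' N (\<lambda>s''. is_threshold ys d (s'' ''p'' 0) \<and> frame l s' s'')"
    if "instance_at s' l d ys" "0 \<le> d" "d < cost_sum ys" "length ys \<le> pruned_size ?m" for s' d ys
    by (rule runs_mono[OF less.hyps]) (use that pruned_less in \<open>auto simp: N_def\<close>)
  have below: "runs ?P (retain (Less (Cell ''k'' (Var ''i'')) (Var ''p'')) ;; Call 0) s'
      (100 * (?m + 1) + N) ?Q" if R: "?R2 s'" and "s' ''b'' 0 < s' ''L'' 0" for s'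
  proof (rule runs_Seq[OF runs_retain[where l = l and m = ?m and Q = "\<lambda>p y. y < p"]])
    fix s''
    let ?ys = "filter (\<lambda>x. fst x < s' ''p'' 0) xs"
    have sg: "seg s' l ?m = xs"
      using R by (simp add: instance_at_def)
    assume "(\<forall>a. a \<notin> {''i'', ''j'', ''k'', ''u'', ''hi''} \<longrightarrow> s'' a = s' a) \<and>
      s'' ''hi'' 0 = l + int (length (filter (\<lambda>x. fst x < s' ''p'' 0) (seg s' l ?m))) \<and>
      seg s'' l (length (filter (\<lambda>x. fst x < s' ''p'' 0) (seg s' l ?m))) =
        filter (\<lambda>x. fst x < s' ''p'' 0) (seg s' l ?m) \<and>
      (\<forall>i<l. s'' ''k'' i = s' ''k'' i \<and> s'' ''u'' i = s' ''u'' i)"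
    then have "instance_at s'' l b ?ys" "frame l s' s''"
      using R unfolding sg by (auto simp: instance_at_def frame_def)
    moreover have lt: "b < cost_sum ?ys"
      using that by (simp add: instance_at_def)
    ultimately show "runs ?P (Call 0) s'' N ?Q"
      using R less.prems(2)
      by (intro runs_mono[OF call[of s'' b ?ys]])
        (auto intro: frame_trans is_threshold_below[OF lt])
  qed (use R in \<open>auto simp: instance_at_def\<close>)
  have above: "runs ?P (Set_var ''b'' (Sub (Var ''b'') (Add (Var ''L'') (Var ''E''))) ;;
      retain (Less (Var ''p'') (Cell ''k'' (Var ''i''))) ;; Call 0) s'
      (100 * (?m + 1) + N + 20) ?Q"
    if R: "?R2 s'" and ge: "\<not> s' ''b'' 0 < s' ''L'' 0 + s' ''E'' 0" for s'
  proof (rule runs_Seq[where t = 20 and t' = "100 * (?m + 1) + N" and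
        R = "\<lambda>s''. s'' = effect (Set_var ''b'' (Sub (Var ''b'') (Add (Var ''L'') (Var ''E'')))) s'"])
    fix s1 assume s1: "s1 = effect (Set_var ''b'' (Sub (Var ''b'') (Add (Var ''L'') (Var ''E'')))) s'"
    let ?ys = "filter (\<lambda>x. s' ''p'' 0 < fst x) xs"
    let ?d = "b - cost_sum (filter (\<lambda>x. fst x \<le> s' ''p'' 0) xs)"
    have b1: "s1 ''b'' 0 = ?d" and ge': "cost_sum (filter (\<lambda>x. fst x \<le> s' ''p'' 0) xs) \<le> b"
      using R ge by (simp_all add: s1 instance_at_def cost_sum_le_split)
    have sg: "seg s1 l ?m = xs" and p1: "s1 ''p'' 0 = s' ''p'' 0"
      using R by (simp_all add: instance_at_def s1 seg_def)
    show "runs ?P (retain (Less (Var ''p'') (Cell ''k'' (Var ''i''))) ;; Call 0) s1 (100 * (?m + 1) + N) ?Q"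
    proof (rule runs_Seq[OF runs_retain[where l = l and m = ?m and Q = "\<lambda>p y. p < y"]])
      fix s''
      assume "(\<forall>a. a \<notin> {''i'', ''j'', ''k'', ''u'', ''hi''} \<longrightarrow> s'' a = s1 a) \<and>
        s'' ''hi'' 0 = l + int (length (filter (\<lambda>x. s1 ''p'' 0 < fst x) (seg s1 l ?m))) \<and>
        seg s'' l (length (filter (\<lambda>x. s1 ''p'' 0 < fst x) (seg s1 l ?m))) =
          filter (\<lambda>x. s1 ''p'' 0 < fst x) (seg s1 l ?m) \<and>
        (\<forall>i<l. s'' ''k'' i = s1 ''k'' i \<and> s'' ''u'' i = s1 ''u'' i)"
      then have "instance_at s'' l ?d ?ys" "frame l s' s''"
        using R b1 unfolding sg p1 by (auto simp: instance_at_def frame_def s1)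
      \<comment> \<open>Both sides of \<open>b < cost_sum xs\<close> lose the cost of the keys up to
        the pivot.\<close>
      moreover have "?d < cost_sum ?ys"
        using less.prems(3) cost_sum_split[of xs "s' ''p'' 0"] by simp
      ultimately show "runs ?P (Call 0) s'' N ?Q"
        using R ge'
        by (intro runs_mono[OF call[of s'' ?d ?ys]])
          (auto intro: frame_trans is_threshold_above[OF ge'])
    qed (use R in \<open>auto simp: instance_at_def s1\<close>)
  qed (auto intro!: runs_straight)
  let ?branch = "If (Less (Var ''b'') (Var ''L''))
       (retain (Less (Cell ''k'' (Var ''i'')) (Var ''p'')) ;; Call 0)
       (If (Less (Var ''b'') (Add (Var ''L'') (Var ''E'')))
          Skip
          (Set_var ''b'' (Sub (Var ''b'') (Add (Var ''L'') (Var ''E''))) ;;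
           retain (Less (Var ''p'') (Cell ''k'' (Var ''i''))) ;; Call 0))"
  have branch: "runs ?P ?branch s' (100 * (?m + 1) + N + 50) ?Q" if "?R2 s'" for s'
  proof (rule runs_If[where t = "100 * (?m + 1) + N + 40"])
    assume "bval (Less (Var ''b'') (Var ''L'')) s'"
    then show "runs ?P (retain (Less (Cell ''k'' (Var ''i'')) (Var ''p'')) ;; Call 0) s'
        (100 * (?m + 1) + N + 40) ?Q"
      by (intro runs_mono[OF below[OF that]]) auto
  next
    assume ge: "\<not> bval (Less (Var ''b'') (Var ''L'')) s'"
    show "runs ?P (If (Less (Var ''b'') (Add (Var ''L'') (Var ''E'')))
          Skip
          (Set_var ''b'' (Sub (Var ''b'') (Add (Var ''L'') (Var ''E''))) ;;
           retain (Less (Var ''p'') (Cell ''k'' (Var ''i''))) ;; Call 0)) s' (100 * (?m + 1) + N + 40) ?Q"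
    proof (rule runs_If[where t = "100 * (?m + 1) + N + 20"])
      assume "bval (Less (Var ''b'') (Add (Var ''L'') (Var ''E''))) s'"
      \<comment> \<open>Here \<open>L \<le> b < L + E\<close>, so the pivot itself is the
        threshold.\<close>
      with ge that show "runs ?P Skip s' (100 * (?m + 1) + N + 20) ?Q"
        by (intro runs_straight) (auto simp: is_threshold_def instance_at_def cost_sum_le_split)
    next
      assume "\<not> bval (Less (Var ''b'') (Add (Var ''L'') (Var ''E''))) s'"
      then show "runs ?P (Set_var ''b'' (Sub (Var ''b'') (Add (Var ''L'') (Var ''E''))) ;;
           retain (Less (Var ''p'') (Cell ''k'' (Var ''i''))) ;; Call 0) s' (100 * (?m + 1) + N + 20) ?Q"
        by (intro above[OF that]) auto
    qed simp
  qed simp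
  note rest = runs_Seq[OF sums branch le_refl]
  have "runs ?P find_threshold s (34000 * ?m - 1) ?Q"
  proof (rule runs_Seq[OF pivot rest, folded find_threshold_def])
    show "600 * (?m + 1) + 34000 * (?m div 9) + (100 * (?m + 1) + 12 + (100 * (?m + 1) + N + 50))
      \<le> 34000 * ?m - 1"
      unfolding N_def using m le_refl by (rule time_recurrence)
  qed assumption+
  moreover have "34000 * ?m - 1 + 1 \<le> 34000 * ?m"
    using m by simp
  ultimately show ?case
    using runs_Call[of 0 ?P s] by simp
qed
section \<open>The adversarial problem\<close>

text \<open>\<open>p\<close> acts as a Lagrange multiplier of the budget. \<open>C\<close> contains
  every item with \<open>p - w i\<close> positive and none with it negative, so it maximises the sum
  of \<open>p - w i\<close>. If \<open>D\<close> had more elements, then \<open>p\<close> would be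
  at most \<open>sum w D - sum w C\<close>, hence at most the leftover budget of \<open>C\<close>,
  which is less than \<open>p\<close>.\<close>

lemma threshold_choice_optimal:
  fixes w :: "nat \<Rightarrow> nat" and p :: int
  assumes "finite X" "C \<subseteq> X" "D \<subseteq> X"
    and below: "\<And>i. i \<in> X \<Longrightarrow> int (w i) < p \<Longrightarrow> i \<in> C"
    and above: "\<And>i. i \<in> C \<Longrightarrow> int (w i) \<le> p"
    and "sum w C \<le> B" "int B - int (sum w C) < p" "sum w D \<le> B"
  shows "card D \<le> card C"
proof (rule ccontr)
  assume "\<not> card D \<le> card C"
  have fin: "finite C" "finite D"
    using assms(1-3) by (auto intro: finite_subset)
  have "(\<Sum>i\<in>D. p - int (w i)) = (\<Sum>i\<in>D \<inter> C. p - int (w i)) + (\<Sum>i\<in>D - C. p - int (w i))"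
    using fin by (simp add: sum.Int_Diff)
  also have "(\<Sum>i\<in>D - C. p - int (w i)) \<le> 0"
    using below assms(3) by (intro sum_nonpos) (meson DiffD1 DiffD2 diff_le_0_iff_le not_le subsetD)
  also have "(\<Sum>i\<in>D \<inter> C. p - int (w i)) \<le> (\<Sum>i\<in>C. p - int (w i))"
    using fin by (intro sum_mono2) (auto simp: above)
  finally have "p * (int (card D) - int (card C)) \<le> int (sum w D) - int (sum w C)"
    by (simp add: sum_subtractf algebra_simps)
  moreover have "0 \<le> p"
    using assms(6,7) by linarith
  then have "p * 1 \<le> p * (int (card D) - int (card C))"
    using \<open>\<not> card D \<le> card C\<close> by (intro mult_left_mono) auto
  ultimately show False
    using assms(7,8) by linarith
qed

text \<open>Passes from 0-1 vectors to sets of indices with \<open>x i = 1\<close>.\<close>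

lemma adversary_value_eq_card:
  assumes x: "\<forall>i\<in>{1..n}. x i \<in> {0, 1}"
    and "C \<subseteq> {i \<in> {1..n}. x i = 1}" "sum w C \<le> B"
    and opt: "\<And>D. D \<subseteq> {i \<in> {1..n}. x i = 1} \<Longrightarrow> sum w D \<le> B \<Longrightarrow> card D \<le> card C"
  shows "feasible n w B (\<lambda>i. of_bool (i \<in> C))"
    and "(\<Sum>i=1..n. x i * of_bool (i \<in> C)) = card C"
    and "adversary_value n w B x = card C"
proof -
  have C: "C \<subseteq> {1..n}" "{1..n} \<inter> C = C" "\<And>i. i \<in> C \<Longrightarrow> x i = 1"
    using assms(2) by auto
  show feas: "feasible n w B (\<lambda>i. of_bool (i \<in> C))"
    using assms(3) C by (simp add: feasible_def sum.If_cases of_bool_def if_distrib cong: if_cong)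
  have "(\<Sum>i=1..n. x i * of_bool (i \<in> C)) = (\<Sum>i\<in>C. x i)"
    using C by (simp add: sum.If_cases of_bool_def if_distrib cong: if_cong)
  also have "\<dots> = card C"
    using C(3) by simp
  finally show val: "(\<Sum>i=1..n. x i * of_bool (i \<in> C)) = card C" .
  show "adversary_value n w B x = card C"
    unfolding adversary_value_def
  proof (rule Max_eqI[OF finite_adversary_values])
    fix y assume "y \<in> {(\<Sum>i=1..n. x i * c i) | c. feasible n w B c}"
    then obtain c where y: "y = (\<Sum>i=1..n. x i * c i)" and c: "feasible n w B c"
      by blast
    \<comment> \<open>Dropping the indices with \<open>x i = 0\<close> keeps the value and cannot
      raise the weight.\<close>
    define D where "D = {i \<in> {1..n}. x i = 1 \<and> c i = 1}"
    have "y = (\<Sum>i=1..n. of_bool (i \<in> D))"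
      unfolding y
    proof (intro sum.cong refl)
      fix i assume i: "i \<in> {1..n}"
      then have "x i \<in> {0, 1}" "c i \<in> {0, 1}"
        using x c unfolding feasible_def by blast+
      with i show "x i * c i = of_bool (i \<in> D)"
        by (auto simp: D_def)
    qed
    also have "\<dots> = card D"
      by (simp add: D_def Int_def conj_commute flip: of_bool_def)
    finally have "y = card D" .
    moreover have "sum w D \<le> (\<Sum>i=1..n. w i * c i)"
    proof -
      have "sum w D = (\<Sum>i\<in>D. w i * c i)"
        by (simp add: D_def)
      also have "\<dots> \<le> (\<Sum>i=1..n. w i * c i)"
        by (intro sum_mono2) (auto simp: D_def)
      finally show ?thesis .
    qed
    ultimately show "y \<le> card C"
      using opt[of D] c by (auto simp: D_def feasible_def)
  next
    show "card C \<in> {(\<Sum>i=1..n. x i * c i) | c. feasible n w B c}"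
      using feas val by (intro CollectI exI[of _ "\<lambda>i. of_bool (i \<in> C)"]) auto
  qed
qed

section \<open>The complete program\<close>

abbreviation item :: "vname \<Rightarrow> aexp" where
  "item a \<equiv> Cell a (Var ''i'')"

abbreviation Items :: "com \<Rightarrow> com" where
  "Items c \<equiv> While (Less (Var ''i'') (Add (Var ''n'') (Const 1))) (c ;; Incr ''i'' 1)"

text \<open>Relies on zero-initialised memory: items with \<open>x i = 0\<close> keep cost 0 in
  \<open>u\<close>, and \<open>lo\<close> already points at the sentinel in cell 0.\<close>

definition load :: com where
  "load =
     (Assign ''k'' (Const 0) (Add (Var ''B'') (Const 1)) ;;
      Assign ''u'' (Const 0) (Add (Var ''B'') (Const 1)) ;;
      Set_var ''hi'' (Add (Var ''n'') (Const 1)) ;;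
      Set_var ''b'' (Var ''B'') ;;
      Set_var ''i'' (Const 1)) ;;
     Items
       (Assign ''k'' (Var ''i'') (item ''w'') ;;
        If (Eq (item ''x'') (Const 1)) (Assign ''u'' (Var ''i'') (item ''w'')) Skip)"

definition take_greedily :: "bexp \<Rightarrow> com" where
  "take_greedily test =
     Set_var ''i'' (Const 1) ;;
     Items
       (If (Conj (Conj (Eq (item ''x'') (Const 1)) test) (Neg (Less (Var ''b'') (item ''w''))))
          (Assign ''c'' (Var ''i'') (Const 1) ;;
           Set_var ''b'' (Sub (Var ''b'') (item ''w'')) ;;
           Incr ''phi'' 1)
          Skip)"

definition solve :: com where
  "solve =
     load ;; Call 0 ;;
     Set_var ''b'' (Var ''B'') ;;
     take_greedily (Less (item ''w'') (Var ''p'')) ;;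
     take_greedily (Eq (item ''w'') (Var ''p''))"

text \<open>The sentinel of weight \<open>B + 1\<close> makes the total cost exceed the budget, so that a threshold
  always exists.\<close>

definition items :: "nat \<Rightarrow> (nat \<Rightarrow> nat) \<Rightarrow> (nat \<Rightarrow> nat) \<Rightarrow> nat \<Rightarrow> (int \<times> int) list" where
  "items n x w B = (int B + 1, int B + 1) #
     map (\<lambda>i. (int (w i), if x i = 1 then int (w i) else 0)) [1..<n + 1]"

lemma items_Suc:
  "items (Suc n) x w B = items n x w B @
     [(int (w (Suc n)), if x (Suc n) = 1 then int (w (Suc n)) else 0)]"
  by (simp add: items_def)

text \<open>Turns both halves of the threshold condition into weight sums over index sets, with the
  sentinel split off.\<close>

lemma cost_sum_items:
  "cost_sum (filter (\<lambda>y. Q (fst y)) (items n x w B)) =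
     (if Q (int B + 1) then int B + 1 else 0) + (\<Sum>i | i \<in> {1..n} \<and> x i = 1 \<and> Q (int (w i)). int (w i))"
proof -
  let ?X = "\<lambda>n. {i. i \<in> {1..n} \<and> x i = 1 \<and> Q (int (w i))}"
  have "cost_sum (filter (\<lambda>y. Q (fst y)) (map (\<lambda>i. (int (w i), if x i = 1 then int (w i) else 0)) [1..<n + 1]))
    = (\<Sum>i\<in>?X n. int (w i))"
  proof (induction n)
    case (Suc n)
    have "?X (Suc n) = (if x (Suc n) = 1 \<and> Q (int (w (Suc n))) then insert (Suc n) (?X n) else ?X n)"
      by (auto simp: le_Suc_eq)
    with Suc show ?case
      by simp
  qed simp
  then show ?thesis
    by (simp add: items_def)
qed

lemma runs_load:
  "runs P load (input_state n x w B) (100 * (n + 1)) (\<lambda>s'.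
     instance_at s' 0 (int B) (items n x w B) \<and>
     (\<forall>a\<in>{''n'', ''B'', ''x'', ''w'', ''c'', ''phi''}. s' a = input_state n x w B a))"
proof -
  let ?s = "input_state n x w B"
  let ?body = "Assign ''k'' (Var ''i'') (item ''w'') ;;
        If (Eq (item ''x'') (Const 1)) (Assign ''u'' (Var ''i'') (item ''w'')) Skip"
  let ?init = "Assign ''k'' (Const 0) (Add (Var ''B'') (Const 1)) ;;
      Assign ''u'' (Const 0) (Add (Var ''B'') (Const 1)) ;;
      Set_var ''hi'' (Add (Var ''n'') (Const 1)) ;;
      Set_var ''b'' (Var ''B'') ;;
      Set_var ''i'' (Const 1)"
  \<comment> \<open>The clause on \<open>u\<close> beyond \<open>t\<close> is carried along because
    the loop writes no cost when \<open>x i\<close> differs from 1.\<close>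
  define I where "I t s' \<longleftrightarrow>
    s' ''i'' 0 = 1 + int t \<and> s' ''lo'' 0 = 0 \<and> s' ''hi'' 0 = int n + 1 \<and> s' ''b'' 0 = int B \<and>
    (\<forall>a\<in>{''n'', ''B'', ''x'', ''w'', ''c'', ''phi''}. s' a = ?s a) \<and>
    (\<forall>i>int t. s' ''u'' i = 0) \<and> seg s' 0 (Suc t) = items t x w B" for t s'
  have init: "I 0 (effect ?init ?s)"
    by (simp add: I_def items_def seg_Suc input_state_def)
  have step: "bval (Less (Var ''i'') (Add (Var ''n'') (Const 1))) s' \<and>
      I (Suc t) (effect (?body ;; Incr ''i'' 1) s')" if "t < n" "I t s'" for t s'
  proof -
    let ?s' = "effect (?body ;; Incr ''i'' 1) s'"
    have n: "s' ''n'' 0 = int n"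
      using that by (simp add: I_def input_state_def)
    have xw: "s' ''x'' (1 + int t) = int (x (Suc t))" "s' ''w'' (1 + int t) = int (w (Suc t))"
      using that by (simp_all add: I_def input_state_def nat_add_distrib)
    have "seg ?s' 0 (Suc t) = seg s' 0 (Suc t)"
      using that by (intro seg_cong) (auto simp: I_def)
    moreover have "?s' ''k'' (1 + int t) = int (w (Suc t))"
      "?s' ''u'' (1 + int t) = (if x (Suc t) = 1 then int (w (Suc t)) else 0)"
      using that xw by (auto simp: I_def)
    ultimately have "seg ?s' 0 (Suc (Suc t)) = items (Suc t) x w B"
      using that(2) unfolding seg_Suc[of _ _ "Suc t"] items_Suc I_def
      by (simp only: of_nat_Suc add_0)
    then show ?thesis
      using that n unfolding I_def by auto
  qed
  have len: "length (items n x w B) = Suc n"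
    by (simp add: items_def)
  show ?thesis
    unfolding load_def
  proof (rule runs_Seq[where t = 40 and t' = "60 * (n + 1)" and R = "I 0"])
    show "runs P ?init ?s 40 (I 0)"
      using init by (intro runs_straight) simp_all
  next
    fix s' assume "I 0 s'"
    then show "runs P (Items ?body) s' (60 * (n + 1)) (\<lambda>s'. instance_at s' 0 (int B) (items n x w B) \<and>
     (\<forall>a\<in>{''n'', ''B'', ''x'', ''w'', ''c'', ''phi''}. s' a = ?s a))"
    proof (rule runs_While[where n = n and I = I, rotated, OF _ step])
      show "\<not> bval (Less (Var ''i'') (Add (Var ''n'') (Const 1))) s'' \<and>
          instance_at s'' 0 (int B) (items n x w B) \<and>
          (\<forall>a\<in>{''n'', ''B'', ''x'', ''w'', ''c'', ''phi''}. s'' a = ?s a)" if "I n s''" for s''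
        using that unfolding instance_at_def len by (simp add: I_def input_state_def)
    qed simp_all
  qed simp
qed

text \<open>\<open>C\<close> is ghost data: the memory holds its indicator in \<open>c\<close>, its
  size in \<open>phi\<close> and its leftover budget in \<open>b\<close>.\<close>

definition chosen :: "nat \<Rightarrow> (nat \<Rightarrow> nat) \<Rightarrow> (nat \<Rightarrow> nat) \<Rightarrow> nat \<Rightarrow> int \<Rightarrow> nat set \<Rightarrow> state \<Rightarrow> bool" where
  "chosen n x w B p C s \<longleftrightarrow>
     (\<forall>a\<in>{''n'', ''B'', ''x'', ''w''}. s a = input_state n x w B a) \<and> s ''p'' 0 = p \<and>
     C \<subseteq> {i \<in> {1..n}. x i = 1} \<and> sum w C \<le> B \<and>
     (\<forall>i\<in>{1..n}. s ''c'' (int i) = of_bool (i \<in> C)) \<and>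
     s ''b'' 0 = int B - int (sum w C) \<and> s ''phi'' 0 = int (card C)"

text \<open>The leftover budget only shrinks, so an item refused once still does not fit next to the
  final set.\<close>

lemma runs_take_greedily:
  assumes "chosen n x w B p C s"
    and test: "\<And>s. bval test s \<longleftrightarrow> Q (s ''p'' 0) (s ''w'' (s ''i'' 0))"
    and cost: "bcost test \<le> 10"
    and disj: "\<And>i. i \<in> C \<Longrightarrow> \<not> Q p (int (w i))"
  shows "runs P (take_greedily test) s (100 * (n + 1)) (\<lambda>s'.
    \<exists>D. chosen n x w B p D s' \<and> C \<subseteq> D \<and> (\<forall>i\<in>D - C. Q p (int (w i))) \<and>
      (\<forall>i\<in>{1..n}. x i = 1 \<and> Q p (int (w i)) \<and> i \<notin> D \<longrightarrow> B < sum w D + w i))"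
proof -
  define I where "I t s' \<longleftrightarrow> s' ''i'' 0 = 1 + int t \<and>
    (\<exists>D. chosen n x w B p D s' \<and> C \<subseteq> D \<and> (\<forall>i\<in>D - C. Q p (int (w i)) \<and> i \<le> t) \<and>
      (\<forall>i\<in>{1..t}. x i = 1 \<and> Q p (int (w i)) \<and> i \<notin> D \<longrightarrow> B < sum w D + w i))" for t s'
  let ?body = "If (Conj (Conj (Eq (item ''x'') (Const 1)) test) (Neg (Less (Var ''b'') (item ''w''))))
          (Assign ''c'' (Var ''i'') (Const 1) ;;
           Set_var ''b'' (Sub (Var ''b'') (item ''w'')) ;;
           Incr ''phi'' 1)
          Skip"
  have init: "I 0 (effect (Set_var ''i'' (Const 1)) s)"
    using assms(1) by (auto simp: I_def chosen_def)
  have step: "bval (Less (Var ''i'') (Add (Var ''n'') (Const 1))) s' \<and>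
      I (Suc t) (effect (?body ;; Incr ''i'' 1) s')" if "t < n" "I t s'" for t s'
  proof -
    obtain D where D: "chosen n x w B p D s'" "C \<subseteq> D" "\<forall>i\<in>D - C. Q p (int (w i)) \<and> i \<le> t"
      "\<forall>i\<in>{1..t}. x i = 1 \<and> Q p (int (w i)) \<and> i \<notin> D \<longrightarrow> B < sum w D + w i"
      and i: "s' ''i'' 0 = 1 + int t"
      using \<open>I t s'\<close> unfolding I_def by blast
    have n: "s' ''n'' 0 = int n"
      using D(1) by (simp add: chosen_def input_state_def)
    have xw: "s' ''x'' (1 + int t) = int (x (Suc t))" "s' ''w'' (1 + int t) = int (w (Suc t))"
      using D(1) that(1) by (simp_all add: chosen_def input_state_def nat_add_distrib)
    have fin: "finite D"
      using D(1) by (auto simp: chosen_def intro: finite_subset)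
    have "s' ''p'' 0 = p"
      using D(1) by (simp add: chosen_def)
    then have tst: "bval test s' \<longleftrightarrow> Q p (int (w (Suc t)))"
      by (simp add: test i xw)
    have bD: "s' ''b'' 0 = int B - int (sum w D)"
      using D(1) by (simp add: chosen_def)
    have less: "bval (Less (Var ''i'') (Add (Var ''n'') (Const 1))) s'"
      using n i that(1) by simp
    show ?thesis
    proof (cases "x (Suc t) = 1 \<and> Q p (int (w (Suc t))) \<and> sum w D + w (Suc t) \<le> B")
      case True
      \<comment> \<open>No item is taken twice: earlier passes took none satisfying
        \<open>Q\<close>, and this pass has only reached index \<open>t\<close>.\<close>
      then have "Suc t \<notin> C"
        using disj by blast
      with D(3) have notin: "Suc t \<notin> D"
        using Suc_n_not_le_n by blast
      have b: "bval (Conj (Conj (Eq (item ''x'') (Const 1)) test) (Neg (Less (Var ''b'') (item ''w'')))) s'"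
        using True by (simp add: tst i xw bD del: of_nat_sum)
      define s'' where "s'' = effect (?body ;; Incr ''i'' 1) s'"
      have s'': "s'' a = s' a" if "a \<notin> {''c'', ''b'', ''phi'', ''i''}" for a
        using that b by (simp add: s''_def del: bval.simps)
      have "s'' ''c'' = (s' ''c'')(1 + int t := 1)"
        "s'' ''b'' 0 = s' ''b'' 0 - int (w (Suc t))" "s'' ''phi'' 0 = s' ''phi'' 0 + 1"
        and i'': "s'' ''i'' 0 = 1 + int (Suc t)"
        using b i xw(2) by (simp_all add: s''_def del: bval.simps)
      then have "chosen n x w B p (insert (Suc t) D) s''"
        using D(1) True notin fin \<open>t < n\<close> unfolding chosen_def by (simp add: s'')
      moreover have "\<forall>i\<in>{1..Suc t}. x i = 1 \<and> Q p (int (w i)) \<and> i \<notin> insert (Suc t) D \<longrightarrow>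
          B < sum w (insert (Suc t) D) + w i"
        using D(4) notin fin by (auto simp: le_Suc_eq)
      moreover have "\<forall>i\<in>insert (Suc t) D - C. Q p (int (w i)) \<and> i \<le> Suc t"
        using D(3) True by (auto intro: le_SucI)
      ultimately show ?thesis
        using less D(2) i'' unfolding I_def s''_def[symmetric]
        by (intro conjI exI[of _ "insert (Suc t) D"]) blast+
    next
      case False
      have b: "\<not> bval (Conj (Conj (Eq (item ''x'') (Const 1)) test) (Neg (Less (Var ''b'') (item ''w'')))) s'"
        using False by (auto simp: tst i xw bD simp del: of_nat_sum)
      define s'' where "s'' = effect (?body ;; Incr ''i'' 1) s'"
      have s'': "s'' a = s' a" if "a \<noteq> ''i''" for a
        using that b by (simp add: s''_def del: bval.simps)
      have i'': "s'' ''i'' 0 = 1 + int (Suc t)"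
        using b i by (simp add: s''_def del: bval.simps)
      have "chosen n x w B p D s''"
        using D(1) unfolding chosen_def by (simp add: s'')
      moreover have "\<forall>i\<in>{1..Suc t}. x i = 1 \<and> Q p (int (w i)) \<and> i \<notin> D \<longrightarrow> B < sum w D + w i"
        using D(4) False by (auto simp: le_Suc_eq)
      moreover have "\<forall>i\<in>D - C. Q p (int (w i)) \<and> i \<le> Suc t"
        using D(3) by (auto intro: le_SucI)
      ultimately show ?thesis
        using less D(2) i'' unfolding I_def s''_def[symmetric]
        by (intro conjI exI[of _ D]) blast+
    qed
  qed
  show ?thesis
    unfolding take_greedily_def
  proof (rule runs_Seq[where t = 10 and t' = "80 * (n + 1)" and R = "I 0"])
    show "runs P (Set_var ''i'' (Const 1)) s 10 (I 0)"
      using init by (intro runs_straight) simp_all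
  next
    fix s' assume "I 0 s'"
    then show "runs P (Items ?body) s' (80 * (n + 1)) (\<lambda>s'.
      \<exists>D. chosen n x w B p D s' \<and> C \<subseteq> D \<and> (\<forall>i\<in>D - C. Q p (int (w i))) \<and>
        (\<forall>i\<in>{1..n}. x i = 1 \<and> Q p (int (w i)) \<and> i \<notin> D \<longrightarrow> B < sum w D + w i))"
    proof (rule runs_While[where n = n and I = I, rotated, OF _ step])
      show "\<not> bval (Less (Var ''i'') (Add (Var ''n'') (Const 1))) s'' \<and>
          (\<exists>D. chosen n x w B p D s'' \<and> C \<subseteq> D \<and> (\<forall>i\<in>D - C. Q p (int (w i))) \<and>
            (\<forall>i\<in>{1..n}. x i = 1 \<and> Q p (int (w i)) \<and> i \<notin> D \<longrightarrow> B < sum w D + w i))"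
        if "I n s''" for s''
      proof -
        have "s'' ''i'' 0 = 1 + int n" "s'' ''n'' 0 = int n"
          using that by (auto simp: I_def chosen_def input_state_def)
        then have "\<not> bval (Less (Var ''i'') (Add (Var ''n'') (Const 1))) s''"
          by simp
        with that show ?thesis
          unfolding I_def by blast
      qed
      have "bcost (Less (Var ''i'') (Add (Var ''n'') (Const 1))) + 1 + ccost (?body ;; Incr ''i'' 1) \<le> 80"
        using cost by simp
      then show "(n + 1) * (bcost (Less (Var ''i'') (Add (Var ''n'') (Const 1))) + 1 +
          ccost (?body ;; Incr ''i'' 1)) \<le> 80 * (n + 1)"
        by (metis mult.commute mult_le_mono2)
    qed simp_all
  qed simp
qed

text \<open>The first greedy pass takes all relevant items lighter than the threshold, the second
  fills up with items of exactly that weight. The result meets the conditions of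
  \<open>threshold_choice_optimal\<close>.\<close>

lemma runs_solve:
  assumes x: "\<forall>i\<in>{1..n}. x i \<in> {0, 1}"
  shows "runs [find_threshold] solve (input_state n x w B) (35000 * (n + 1)) (correct_output n x w B)"
proof -
  let ?P = "[find_threshold]" and ?s = "input_state n x w B"
  let ?X = "{i \<in> {1..n}. x i = 1}"
  have len: "length (items n x w B) = n + 1"
    by (simp add: items_def)
  have exceeds: "int B < cost_sum (items n x w B)"
    using cost_sum_items[of "\<lambda>_. True" n x w B] by (simp add: sum_nonneg add_pos_nonneg)
  have final: "correct_output n x w B s'"
    if p: "is_threshold (items n x w B) (int B) p"
      and C: "chosen n x w B p C s" "\<forall>i\<in>C. int (w i) < p"
        "\<forall>i\<in>{1..n}. x i = 1 \<and> int (w i) < p \<and> i \<notin> C \<longrightarrow> B < sum w C + w i"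
      and D: "chosen n x w B p D s'" "C \<subseteq> D" "\<forall>i\<in>D - C. int (w i) = p"
        "\<forall>i\<in>{1..n}. x i = 1 \<and> int (w i) = p \<and> i \<notin> D \<longrightarrow> B < sum w D + w i"
    for p C D s s'
  proof -
    let ?A = "{i. i \<in> {1..n} \<and> x i = 1 \<and> int (w i) < p}"
    let ?A' = "{i. i \<in> {1..n} \<and> x i = 1 \<and> int (w i) \<le> p}"
    have CX: "C \<subseteq> ?X" and DX: "D \<subseteq> ?X" and wD: "sum w D \<le> B"
      using C(1) D(1) by (auto simp: chosen_def)
    \<comment> \<open>The lower half of the threshold condition, less the nonnegative sentinel
      term.\<close>
    have "sum w ?A \<le> B"
      using p cost_sum_items[of "\<lambda>y. y < p" n x w B]
      by (auto simp: is_threshold_def simp flip: of_nat_sum split: if_splits)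
    \<comment> \<open>A refused light item would make \<open>insert i C\<close>, a subset of
      \<open>?A\<close>, exceed the budget that all of \<open>?A\<close> respects.\<close>
    have all_below: "i \<in> C" if "i \<in> ?X" "int (w i) < p" for i
    proof (rule ccontr)
      assume "i \<notin> C"
      then have "B < sum w (insert i C)"
        using C(3) that CX finite_subset[OF CX] by auto
      also have "\<dots> \<le> sum w ?A"
        using C(2) CX that by (intro sum_mono2) auto
      finally show False
        using \<open>sum w ?A \<le> B\<close> by simp
    qed
    have below: "i \<in> D" if "i \<in> ?X" "int (w i) < p" for i
      using all_below[OF that] D(2) by blast
    have above: "int (w i) \<le> p" if "i \<in> D" for i
      using C(2) D(3) that by (cases "i \<in> C") (simp_all add: less_imp_le)
    \<comment> \<open>Either an item of weight \<open>p\<close> was refused, so the leftover is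
      below \<open>p\<close>, or \<open>D\<close> consists of all relevant items of weight at most
      \<open>p\<close>.\<close>
    have "int B - int (sum w D) < p"
    proof (cases "\<exists>i\<in>?X. int (w i) = p \<and> i \<notin> D")
      case True
      then obtain i where "i \<in> ?X" "int (w i) = p" "i \<notin> D"
        by blast
      with D(4) have "B < sum w D + w i"
        by blast
      with \<open>int (w i) = p\<close> show ?thesis
        by linarith
    next
      case False
      have "D = ?A'"
      proof (intro equalityI subsetI)
        show "i \<in> ?A'" if "i \<in> D" for i
          using DX above[OF that] that by blast
      next
        fix i assume i: "i \<in> ?A'"
        show "i \<in> D"
        proof (cases "int (w i) < p")
          case True
          with i below show ?thesis by simp
        next
          case not_less: False
          with i have "int (w i) = p" "i \<in> ?X"
            by simp_all
          with False show ?thesis by blast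
        qed
      qed
      \<comment> \<open>As \<open>sum w D \<le> B\<close>, the sentinel must be counted here, so
        \<open>B + 1 \<le> p\<close> and any leftover is below \<open>p\<close>.\<close>
      moreover have "int B < (if int B + 1 \<le> p then int B + 1 else 0) + int (sum w ?A')"
        using p cost_sum_items[of "\<lambda>y. y \<le> p" n x w B] by (simp add: is_threshold_def)
      ultimately have "int B < (if int B + 1 \<le> p then int B + 1 else 0) + int (sum w D)"
        by simp
      with wD show ?thesis
        by (cases "int B + 1 \<le> p") (simp_all del: of_nat_sum)
    qed
    then have "card E \<le> card D" if "E \<subseteq> ?X" "sum w E \<le> B" for E
      using threshold_choice_optimal[OF _ DX that(1) below above wD _ that(2)] by simp
    from adversary_value_eq_card[OF x DX wD this] show ?thesis
      using D(1) unfolding correct_output_def chosen_def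
      by (intro conjI exI[of _ "\<lambda>i. of_bool (i \<in> D)"]) auto
  qed
  define R where "R s \<longleftrightarrow> is_threshold (items n x w B) (int B) (s ''p'' 0) \<and>
    (\<forall>a\<in>{''n'', ''B'', ''x'', ''w'', ''c'', ''phi''}. s a = ?s a)" for s
  have call: "runs ?P (Call 0) s (34000 * (n + 1)) R"
    if "instance_at s 0 (int B) (items n x w B) \<and>
     (\<forall>a\<in>{''n'', ''B'', ''x'', ''w'', ''c'', ''phi''}. s a = ?s a)" for s
    by (rule runs_mono[OF runs_find_threshold[of s 0 "int B" "items n x w B"]])
      (use that exceeds in \<open>auto simp: len R_def frame_def\<close>)
  define R' where "R' s \<longleftrightarrow> is_threshold (items n x w B) (int B) (s ''p'' 0) \<and>
    chosen n x w B (s ''p'' 0) {} s" for s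
  have reset: "runs ?P (Set_var ''b'' (Var ''B'')) s 5 R'" if "R s" for s
    by (rule runs_straight) (use that in \<open>auto simp: R_def R'_def chosen_def input_state_def\<close>)
  define R'' where "R'' s \<longleftrightarrow> (\<exists>p C. is_threshold (items n x w B) (int B) p \<and>
    chosen n x w B p C s \<and> (\<forall>i\<in>C. int (w i) < p) \<and>
    (\<forall>i\<in>{1..n}. x i = 1 \<and> int (w i) < p \<and> i \<notin> C \<longrightarrow> B < sum w C + w i))" for s
  have first: "runs ?P (take_greedily (Less (item ''w'') (Var ''p''))) s (100 * (n + 1)) R''"
    if "R' s" for s
  proof -
    have "chosen n x w B (s ''p'' 0) {} s"
      using that by (simp add: R'_def)
    from runs_take_greedily[OF this, where Q = "\<lambda>p y. y < p" and test = "Less (item ''w'') (Var ''p'')"]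
    show ?thesis
      by (rule runs_mono) (use that in \<open>auto simp: R'_def R''_def\<close>)
  qed
  have second: "runs ?P (take_greedily (Eq (item ''w'') (Var ''p''))) s (100 * (n + 1))
      (correct_output n x w B)" if "R'' s" for s
  proof -
    obtain p C where p: "is_threshold (items n x w B) (int B) p" and C: "chosen n x w B p C s"
      "\<forall>i\<in>C. int (w i) < p"
      "\<forall>i\<in>{1..n}. x i = 1 \<and> int (w i) < p \<and> i \<notin> C \<longrightarrow> B < sum w C + w i"
      using \<open>R'' s\<close> unfolding R''_def by blast
    have "\<not> int (w i) = p" if "i \<in> C" for i
      using C(2) that by auto
    from runs_take_greedily[OF C(1), where Q = "\<lambda>p y. y = p" and test = "Eq (item ''w'') (Var ''p'')", OF _ _ this]
    show ?thesis
      by (rule runs_mono) (use final[OF p C] in auto)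
  qed
  show ?thesis
    \<comment> \<open>The sentinel makes \<open>n + 1\<close> items. Loading, search, reset and two
      passes cost at most \<open>34300 * (n + 1) + 5\<close>.\<close>
    unfolding solve_def
    by (rule runs_Seq[OF runs_load runs_Seq[OF call runs_Seq[OF reset runs_Seq[OF first second le_refl] le_refl]
      le_refl]]) auto
qed

theorem mainTheorem3:
  "\<exists>(procs :: com list) (main :: com) (T :: nat \<Rightarrow> nat).
     (\<lambda>n. real (T n)) \<in> O(\<lambda>n. real n) \<and>
     (\<forall>(n :: nat) (x :: nat \<Rightarrow> nat) (w :: nat \<Rightarrow> nat) (B :: nat).
        (\<forall>i\<in>{1..n}. x i \<in> {0, 1}) \<longrightarrow>
        (\<forall>i\<in>{1..n}. w i \<le> B) \<longrightarrow>
        (\<exists>t s. t \<le> T n \<and> exec procs main (input_state n x w B) t s \<and>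
               correct_output n x w B s))"
proof (rule exI[of _ "[find_threshold]"], rule exI[of _ solve],
    rule exI[of _ "\<lambda>n. 35000 * (n + 1)"], intro conjI allI impI)
  \<comment> \<open>For \<open>n \<ge> 1\<close>, \<open>n + 1 \<le> 2 * n\<close> doubles the
    constant.\<close>
  have "\<forall>\<^sub>F n in sequentially. norm (real (35000 * (n + 1))) \<le> 70000 * norm (real n)"
    using eventually_ge_at_top[of 1] by eventually_elim simp
  then show "(\<lambda>n. real (35000 * (n + 1))) \<in> O(\<lambda>n. real n)"
    by (rule bigoI)
next
  fix n B :: nat and x w :: "nat \<Rightarrow> nat"
  assume "\<forall>i\<in>{1..n}. x i \<in> {0, 1}"
  then show "\<exists>t s. t \<le> 35000 * (n + 1) \<and> exec [find_threshold] solve (input_state n x w B) t s \<and>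
      correct_output n x w B s"
    using runs_solve unfolding runs_def by blast
qed

end
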